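(* For every integer $k\ge1$, the matrices $\Xi^{(k)}$ and $K^{(k)}\Upsilon^{(k)}K^{(k)}$, with entries in $\mathbb Z[q,q^{-1}]$ and rows and columns indexed by the compositions of size less than $k$, are inverse to each other.
   Context: Work over $R=\mathbb Z[q,q^{-1}]$. A composition is a finite sequence $\lambda=(\lambda_1,\dots,\lambda_l)$ of positive integers; $\ell(\lambda)=l$, $|\lambda|=\sum\lambda_i$ is its size, and $\emptyset$ is the composition of $0$. For $\lambda\ne\emptyset$, $\lambda'=(\lambda_1,\dots,\lambda_{l-1})$; for $k\ge1$ the map $\lambda\mapsto\lambda'$ is a bijection from compositions of $k$ to compositions of size less than $k$. A prefix of $\lambda$ is any $(\lambda_1,\dots,\lambda_j)$ with $0\le j\le l$. For compositions $\lambda,\mu$, $\lambda\subseteq\mu$ means $|\lambda|=|\mu|$ and $\lambda$ is obtained from $\mu$ by adding together consecutive parts (i.e. $\mu$ refines $\lambda$). Let $\xi=q^{-1}(q-1)^2$, let $[s]_q=(q^s-q^{-s})/(q-q^{-1})$, and set $\mathfrak a(0)=1$, $\mathfrak a(s)=[s]_q\,\xi$ for $s>0$, $a(X)=\sum_{s\ge0}\mathfrak a(s)X^s$. Let $a_d(X_1,\dots,X_m)$ be the homogeneous component of degree $d$ of $\prod_{i=1}^m a(X_i)$. For a composition $\mu$ of length $l$, $p^\mu(X_1,\dots,X_m)=\sum_{1\le i_1<\dots<i_l\le m}X_{i_1}^{\mu_1}\cdots X_{i_l}^{\mu_l}$ (with $p^\emptyset=1$); for compositions with at most $m$ parts these form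 a basis of the quasi-symmetric polynomials in $X_1,\dots,X_m$. For compositions $\lambda,\mu$: $A_{\lambda,\mu}=0$ if $|\lambda|<|\mu|$; if $|\lambda|\ge|\mu|$, $A_{\lambda,\mu}$ is the coefficient of $p^\lambda(X_1,\dots,X_m)$ when the quasi-symmetric polynomial $a_{|\lambda|-|\mu|}(X_1,\dots,X_m)\,p^\mu(X_1,\dots,X_m)$ is expanded in the basis of the $p^\nu$, for any $m\ge\ell(\lambda)$ (it does not depend on $m$). Also $Z_{\lambda,\mu}=1$ if $\lambda=\mu$ or $\lambda=\mu'$, and $0$ otherwise; $K_{\lambda,\mu}=(-1)^{\ell(\mu)}$ if $\lambda\subseteq\nu$ for some prefix $\nu$ of $\mu$, and $0$ otherwise. $A^{(k)},Z^{(k)},K^{(k)}$ denote the matrices of these entries indexed by compositions of size less than $k$. The matrices $\Xi^{(k)},\Upsilon^{(k)}$, indexed by compositions of size less than $k$, are defined recursively by $\Xi^{(1)}=\Upsilon^{(1)}=(1)$ and $$\Xi^{(k+1)}=\begin{pmatrix}\Xi^{(k)}&0\\0&\Xi^{(k)}\end{pmatrix}Z^{(k+1)}A^{(k+1)},\qquad \Upsilon^{(k+1)}=Z^{(k+1)}A^{(k+1)}\begin{pmatrix}\Upsilon^{(k)}&0\\0&\Upsilon^{(k)}\end{pmatrix}.$$ Here the block matrices are indexed by compositions of size less than $k+1$: the first block corresponds to compositions $\lambda$ of size less than $k$, and the second to compositions $\lambda$ of size exactly $k$, identified with compositions of size less than $k$ via $\lambda\mapsto\lambda'$. *)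

theory Defs
  imports
    "HOL-Library.Poly_Mapping"
    "HOL-Library.Sublist"
    "HOL-Computational_Algebra.Formal_Power_Series"
begin

section \<open>The ground ring\<close>

text \<open>
  The convolution ring of finitely supported functions on the integers, with integer values,
  is the Laurent polynomial ring in one variable \<open>q\<close>; \<open>qpow n\<close> is \<open>q\<close> to the power \<open>n\<close>.
\<close>

type_synonym laurent = "int \<Rightarrow>\<^sub>0 int"

definition qpow :: "int \<Rightarrow> laurent" where
  "qpow n = Poly_Mapping.single n 1"

lemma qpow_add: "qpow (m + n) = qpow m * qpow n"
  by (simp add: qpow_def mult_single)

lemma qpow_0 [simp]: "qpow 0 = 1"
  by (simp add: qpow_def)

definition \<xi> :: laurent where
  "\<xi> = qpow (-1) * (qpow 1 - 1)\<^sup>2"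

text \<open>
  The quotient in the definition of the quantum integer is exact; as the ground ring has no
  division, the quotient is the unique solution of the corresponding equation.
\<close>

definition qint :: "nat \<Rightarrow> laurent" where
  "qint s = (THE x. x * (qpow 1 - qpow (-1)) = qpow (int s) - qpow (- int s))"

lemma qint_sum_mult:
  "(\<Sum>i<s. qpow (int s - 1 - 2 * int i)) * (qpow 1 - qpow (-1)) = qpow (int s) - qpow (- int s)"
proof -
  have "qpow (int s - 1 - 2 * int i) * (qpow 1 - qpow (-1)) =
      qpow (int s - 2 * int i) - qpow (int s - 2 * int (Suc i))" for i
    by (simp add: right_diff_distrib diff_diff_eq add.commute flip: qpow_add)
  then show ?thesis
    using sum_lessThan_telescope'[of "\<lambda>i. qpow (int s - 2 * int i)" s]
    by (simp only: sum_distrib_right) simp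
qed

lemma qint_eq_sum: "qint s = (\<Sum>i<s. qpow (int s - 1 - 2 * int i))"
proof -
  have "Poly_Mapping.lookup (qpow 1 - qpow (-1)) 1 = 1"
    by (simp add: qpow_def lookup_minus lookup_single)
  then have nz: "qpow 1 - qpow (-1) \<noteq> 0"
    by auto
  show ?thesis
    unfolding qint_def
  proof (rule the_equality)
    fix x assume "x * (qpow 1 - qpow (-1)) = qpow (int s) - qpow (- int s)"
    then have "x * (qpow 1 - qpow (-1)) =
        (\<Sum>i<s. qpow (int s - 1 - 2 * int i)) * (qpow 1 - qpow (-1))"
      by (simp only: qint_sum_mult)
    with nz show "x = (\<Sum>i<s. qpow (int s - 1 - 2 * int i))"
      by (simp only: mult_cancel_right) blast
  qed (fact qint_sum_mult)
qed

definition \<aa> :: "nat \<Rightarrow> laurent" where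
  "\<aa> s = (if s = 0 then 1 else qint s * \<xi>)"


section \<open>Compositions\<close>

definition composition :: "nat list \<Rightarrow> bool" where
  "composition \<alpha> \<longleftrightarrow> (\<forall>x\<in>set \<alpha>. 0 < x)"

definition comps_less :: "nat \<Rightarrow> nat list set" where
  "comps_less k = {\<alpha>. composition \<alpha> \<and> sum_list \<alpha> < k}"

lemma finite_comps_less: "finite (comps_less k)"
proof (rule finite_subset)
  have len: "length \<alpha> \<le> sum_list \<alpha>" if "composition \<alpha>" for \<alpha>
    using that by (induction \<alpha>) (auto simp: composition_def)
  show "comps_less k \<subseteq> {xs. set xs \<subseteq> {..k} \<and> length xs \<le> k}"
  proof
    fix \<alpha> assume *: "\<alpha> \<in> comps_less k"
    have "x \<le> k" if "x \<in> set \<alpha>" for x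
      using * member_le_sum_list[OF that] by (simp add: comps_less_def)
    with * len[of \<alpha>] show "\<alpha> \<in> {xs. set xs \<subseteq> {..k} \<and> length xs \<le> k}"
      by (auto simp: comps_less_def)
  qed
  show "finite {xs. set xs \<subseteq> {..k} \<and> length xs \<le> k}"
    by (rule finite_lists_length_le) simp
qed

definition coarsens :: "nat list \<Rightarrow> nat list \<Rightarrow> bool" where
  "coarsens \<alpha> \<beta> \<longleftrightarrow> sum_list \<alpha> = sum_list \<beta> \<and>
     (\<exists>bs. (\<forall>b\<in>set bs. b \<noteq> []) \<and> concat bs = \<beta> \<and> map sum_list bs = \<alpha>)"


section \<open>Quasi-symmetric polynomials\<close>

text \<open>
  A monomial is a finitely supported exponent function; the variables of a polynomial in \<open>m\<close>
  variables are those with index in \<open>{1..m}\<close>.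
\<close>

type_synonym mpol = "(nat \<Rightarrow>\<^sub>0 nat) \<Rightarrow>\<^sub>0 laurent"

definition X :: "nat \<Rightarrow> mpol" where
  "X i = Poly_Mapping.single (Poly_Mapping.single i 1) 1"

definition const :: "laurent \<Rightarrow> mpol" where
  "const c = Poly_Mapping.single 0 c"

definition qsym_p :: "nat \<Rightarrow> nat list \<Rightarrow> mpol" where
  "qsym_p m \<beta> =
     (\<Sum>is | length is = length \<beta> \<and> sorted_wrt (<) is \<and> set is \<subseteq> {1..m}.
        \<Prod>j<length \<beta>. X (is ! j) ^ (\<beta> ! j))"

text \<open>
  A power series in \<open>X 1, \<dots>, X m\<close> is recorded by its homogeneous components, the component of
  degree \<open>d\<close> being the coefficient of \<open>T\<close> to the power \<open>d\<close> in a univariate power series over the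
  polynomial ring; this amounts to substituting \<open>X i * T\<close> for \<open>X i\<close>, and is compatible with
  products. The lemma after the definition gives the coefficients in terms of monomials.
\<close>

definition a_series :: "nat \<Rightarrow> mpol fps" where
  "a_series i = Abs_fps (\<lambda>s. const (\<aa> s) * X i ^ s)"

definition a_comp :: "nat \<Rightarrow> nat \<Rightarrow> mpol" where
  "a_comp m d = fps_nth (\<Prod>i\<in>{1..m}. a_series i) d"

lemma X_power: "X i ^ s = Poly_Mapping.single (Poly_Mapping.single i s) 1"
  by (induction s) (simp_all add: X_def mult_single flip: single_add)

lemma lookup_mult_single_var:
  fixes f :: mpol
  shows "Poly_Mapping.lookup (f * Poly_Mapping.single (Poly_Mapping.single i s) c) e =
    (if s \<le> Poly_Mapping.lookup e i
     then Poly_Mapping.lookup f (e - Poly_Mapping.single i s) * c else 0)"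
proof -
  let ?b = "Poly_Mapping.single i s"
  have *: "e = l + ?b \<longleftrightarrow> s \<le> Poly_Mapping.lookup e i \<and> l = e - ?b" for l
    by (auto simp: poly_mapping_eq_iff fun_eq_iff lookup_add lookup_minus lookup_single when_def)
  have "Poly_Mapping.lookup (f * Poly_Mapping.single ?b c) e =
      Sum_any (\<lambda>l. Poly_Mapping.lookup f l * (c when e = l + ?b))"
  proof -
    have "(\<Sum>q. Poly_Mapping.lookup (Poly_Mapping.single ?b c) q when e = l + q) =
        (c when e = l + ?b)" for l
    proof -
      have "(Poly_Mapping.lookup (Poly_Mapping.single ?b c) q when e = l + q) =
          ((c when e = l + ?b) when q = ?b)" for q
        by (auto simp: lookup_single when_def)
      then show ?thesis by simp
    qed
    then show ?thesis by (simp add: lookup_mult)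
  qed
  also have "\<dots> = Sum_any (\<lambda>l. (if s \<le> Poly_Mapping.lookup e i
      then Poly_Mapping.lookup f (e - ?b) * c else 0) when l = e - ?b)"
    by (rule Sum_any.cong) (auto simp: * when_def)
  finally show ?thesis by simp
qed

lemma lookup_a_comp:
  "Poly_Mapping.lookup (a_comp m d) e =
    (if Poly_Mapping.keys e \<subseteq> {1..m} \<and> (\<Sum>i\<in>{1..m}. Poly_Mapping.lookup e i) = d
     then \<Prod>i\<in>{1..m}. \<aa> (Poly_Mapping.lookup e i) else 0)"
proof (induction m arbitrary: d e)
  case 0
  have "Poly_Mapping.lookup (a_comp 0 d) e = (if d = 0 \<and> e = 0 then 1 else 0)"
    by (auto simp: a_comp_def lookup_one when_def)
  then show ?case by auto
next
  case (Suc m)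
  let ?n = "Poly_Mapping.lookup e (Suc m)"
  let ?e = "e - Poly_Mapping.single (Suc m) ?n"
  have term_eq: "const (\<aa> s) * X (Suc m) ^ s =
      Poly_Mapping.single (Poly_Mapping.single (Suc m) s) (\<aa> s)" for s
    by (simp add: const_def X_power mult_single)
  have rest: "Poly_Mapping.lookup ?e i = (if i = Suc m then 0 else Poly_Mapping.lookup e i)" for i
    by (simp add: lookup_minus lookup_single when_def)
  have keys: "Poly_Mapping.keys ?e \<subseteq> {1..m} \<longleftrightarrow> Poly_Mapping.keys e \<subseteq> {1..Suc m}"
  proof -
    have "Poly_Mapping.keys ?e = Poly_Mapping.keys e - {Suc m}"
      by (auto simp: in_keys_iff rest split: if_splits)
    moreover have "{1..Suc m} = insert (Suc m) {1..m}"
      by (simp add: atLeastAtMostSuc_conv)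
    ultimately show ?thesis by (simp only:) blast
  qed
  have vanish: "Poly_Mapping.lookup (a_comp m (d - s)) (e - Poly_Mapping.single (Suc m) s) = 0"
    if "s < ?n" for s
  proof -
    have "Suc m \<in> Poly_Mapping.keys (e - Poly_Mapping.single (Suc m) s)"
      using that by (simp add: in_keys_iff lookup_minus lookup_single)
    then have "\<not> Poly_Mapping.keys (e - Poly_Mapping.single (Suc m) s) \<subseteq> {1..m}"
      by fastforce
    then show ?thesis by (simp add: Suc.IH)
  qed
  have "a_comp (Suc m) d = (\<Sum>s=0..d. const (\<aa> s) * X (Suc m) ^ s * a_comp m (d - s))"
  proof -
    have "(\<Prod>i\<in>{1..Suc m}. a_series i) = a_series (Suc m) * (\<Prod>i\<in>{1..m}. a_series i)"
      by (simp add: prod.nat_ivl_Suc')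
    then show ?thesis
      by (simp only: a_comp_def fps_mult_nth) (simp add: a_series_def)
  qed
  then have "a_comp (Suc m) d = (\<Sum>s=0..d. a_comp m (d - s) *
      Poly_Mapping.single (Poly_Mapping.single (Suc m) s) (\<aa> s))"
    by (simp add: term_eq mult.commute)
  then have "Poly_Mapping.lookup (a_comp (Suc m) d) e = (\<Sum>s=0..d. if s \<le> ?n then
      Poly_Mapping.lookup (a_comp m (d - s)) (e - Poly_Mapping.single (Suc m) s) * \<aa> s else 0)"
    by (simp add: lookup_sum lookup_mult_single_var)
  also have "\<dots> = (\<Sum>s=0..d. if s = ?n then
      Poly_Mapping.lookup (a_comp m (d - s)) (e - Poly_Mapping.single (Suc m) s) * \<aa> s else 0)"
    by (rule sum.cong) (auto simp: vanish)
  also have "\<dots> = (if ?n \<le> d then Poly_Mapping.lookup (a_comp m (d - ?n)) ?e * \<aa> ?n else 0)"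
    by (simp add: sum.delta)
  also have "\<dots> = (if Poly_Mapping.keys e \<subseteq> {1..Suc m} \<and>
        (\<Sum>i\<in>{1..Suc m}. Poly_Mapping.lookup e i) = d
      then \<Prod>i\<in>{1..Suc m}. \<aa> (Poly_Mapping.lookup e i) else 0)"
  proof -
    have "(\<Sum>i\<in>{1..m}. Poly_Mapping.lookup ?e i) = (\<Sum>i\<in>{1..m}. Poly_Mapping.lookup e i)"
      by (rule sum.cong) (auto simp: rest)
    moreover have "(\<Prod>i\<in>{1..m}. \<aa> (Poly_Mapping.lookup ?e i)) =
        (\<Prod>i\<in>{1..m}. \<aa> (Poly_Mapping.lookup e i))"
      by (rule prod.cong) (auto simp: rest)
    ultimately show ?thesis
      by (simp only: Suc.IH keys) (auto simp: prod.nat_ivl_Suc' sum.nat_ivl_Suc' mult.commute)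
  qed
  finally show ?case .
qed

text \<open>
  The coefficient of the basis element \<open>qsym_p m \<alpha>\<close> in the expansion of \<open>f\<close>; only meaningful
  for quasi-symmetric \<open>f\<close> and compositions \<open>\<alpha>\<close> with at most \<open>m\<close> parts.
\<close>

definition qsym_coeffs :: "nat \<Rightarrow> mpol \<Rightarrow> nat list \<Rightarrow>\<^sub>0 laurent" where
  "qsym_coeffs m f = (THE c.
     Poly_Mapping.keys c \<subseteq> {\<nu>. composition \<nu> \<and> length \<nu> \<le> m} \<and>
     f = (\<Sum>\<nu>\<in>Poly_Mapping.keys c. const (Poly_Mapping.lookup c \<nu>) * qsym_p m \<nu>))"


section \<open>The matrices\<close>

text \<open>
  Matrices are functions of two compositions; only the entries indexed by \<open>comps_less k\<close>
  are relevant.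
\<close>

type_synonym mat = "nat list \<Rightarrow> nat list \<Rightarrow> laurent"

definition A_mat :: mat where
  "A_mat \<alpha> \<beta> = (if sum_list \<alpha> < sum_list \<beta> then 0 else
     (THE r. \<forall>m\<ge>length \<alpha>. Poly_Mapping.lookup
        (qsym_coeffs m (a_comp m (sum_list \<alpha> - sum_list \<beta>) * qsym_p m \<beta>)) \<alpha> = r))"

definition Z_mat :: mat where
  "Z_mat \<alpha> \<beta> = (if \<alpha> = \<beta> \<or> \<beta> \<noteq> [] \<and> \<alpha> = butlast \<beta> then 1 else 0)"

definition K_mat :: mat where
  "K_mat \<alpha> \<beta> = (if \<exists>\<nu>. prefix \<nu> \<beta> \<and> coarsens \<alpha> \<nu> then (-1) ^ length \<beta> else 0)"

definition mat_mult :: "nat \<Rightarrow> mat \<Rightarrow> mat \<Rightarrow> mat" where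
  "mat_mult k M N = (\<lambda>\<alpha> \<beta>. \<Sum>\<nu>\<in>comps_less k. M \<alpha> \<nu> * N \<nu> \<beta>)"

definition mat_id :: mat where
  "mat_id \<alpha> \<beta> = (if \<alpha> = \<beta> then 1 else 0)"

definition mutually_inverse :: "nat \<Rightarrow> mat \<Rightarrow> mat \<Rightarrow> bool" where
  "mutually_inverse k M N \<longleftrightarrow> (\<forall>\<alpha>\<in>comps_less k. \<forall>\<beta>\<in>comps_less k.
     mat_mult k M N \<alpha> \<beta> = mat_id \<alpha> \<beta> \<and> mat_mult k N M \<alpha> \<beta> = mat_id \<alpha> \<beta>)"

text \<open>
  For \<open>k > 0\<close> and \<open>M\<close> indexed by \<open>comps_less k\<close>, the matrix with two diagonal blocks \<open>M\<close> indexed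
  by \<open>comps_less (Suc k)\<close>; removing the last part identifies the compositions of size \<open>k\<close> with
  those of smaller size.
\<close>

definition block_diag :: "nat \<Rightarrow> mat \<Rightarrow> mat" where
  "block_diag k M = (\<lambda>\<alpha> \<beta>.
     if sum_list \<alpha> < k \<and> sum_list \<beta> < k then M \<alpha> \<beta>
     else if sum_list \<alpha> = k \<and> sum_list \<beta> = k then M (butlast \<alpha>) (butlast \<beta>)
     else 0)"

text \<open>
  The index \<open>0\<close> (the empty matrix) carries a dummy value. For index \<open>1\<close> the only relevant entry
  is at the empty composition.
\<close>

fun \<Xi> :: "nat \<Rightarrow> mat" where
  "\<Xi> 0 = mat_id"
| "\<Xi> (Suc 0) = mat_id"
| "\<Xi> (Suc (Suc k)) = mat_mult (Suc (Suc k))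
     (mat_mult (Suc (Suc k)) (block_diag (Suc k) (\<Xi> (Suc k))) Z_mat) A_mat"

fun \<Upsilon> :: "nat \<Rightarrow> mat" where
  "\<Upsilon> 0 = mat_id"
| "\<Upsilon> (Suc 0) = mat_id"
| "\<Upsilon> (Suc (Suc k)) = mat_mult (Suc (Suc k))
     (mat_mult (Suc (Suc k)) Z_mat A_mat) (block_diag (Suc k) (\<Upsilon> (Suc k)))"

end

theory Submission
  imports Defs
begin

text \<open>
  All matrices that occur act on the free associative algebra on generators \<open>H\<^sub>1, H\<^sub>2, \<dots>\<close>,
  the dual of the quasi-symmetric functions. Write \<open>H\<^sub>\<alpha>\<close> for the word of generators that belongs
  to a composition \<open>\<alpha>\<close>, put \<open>H\<^sub>0 = 1\<close>, and let \<open>H(T) = \<Sum>\<^sub>n H\<^sub>n T\<^sup>n\<close>. A matrix \<open>M\<close> is read as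
  the linear map that sends \<open>H\<^sub>\<alpha>\<close> to \<open>\<Sum>\<^sub>\<beta> M\<^sub>\<alpha>\<^sub>\<beta> H\<^sub>\<beta>\<close>.

  Multiplication by \<open>a(X\<^sub>1) a(X\<^sub>2) \<dots>\<close> is dual to an algebra homomorphism, because this product of
  series in single variables is group-like; so \<open>A\<close> is the homomorphism \<open>H(T) \<mapsto> a(T) H(T)\<close>
  (\<open>A_mat_eq_mul_mat\<close>, \<open>mul_mat_ev\<close>). The matrix \<open>C = K Z\<close> has the entry
  \<open>(-1)^length \<beta>\<close> where \<open>\<beta>\<close> refines \<open>\<alpha>\<close> and \<open>0\<close> elsewhere (\<open>K_Z_eq_refine\<close>), and this is the
  homomorphism \<open>H(T) \<mapsto> H(T)\<^sup>-\<^sup>1\<close> (\<open>refine_mat_ev\<close>). The coefficients of \<open>a(T)\<close> are central, so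
  \<open>H(T) \<mapsto> (a(T) H(T))\<^sup>-\<^sup>1\<close> is an involution. In terms of matrices, \<open>(K Z A)\<^sup>2 = 1\<close>
  (\<open>refine_A_involution\<close>, \<open>K_Z_A_involution\<close>).

  The rest is linear algebra with two-by-two blocks. With respect to the blocks in the recursion,
  \<open>K\<close> at level \<open>k + 1\<close> is \<open>diag(K, K) J\<close>, where \<open>J\<close> is the scalar block matrix with rows
  \<open>(1, -1)\<close> and \<open>(0, -1)\<close> (\<open>K_mat_block\<close>). It satisfies \<open>J\<^sup>2 = 1\<close> and commutes with every
  \<open>diag(M, M)\<close>. By induction \<open>K\<^sup>2 = 1\<close>, hence \<open>(K Z A)\<^sup>2 = 1\<close> becomes \<open>Z A K Z A = K\<close>. At
  level \<open>k + 1\<close>, the product \<open>\<Xi> K \<Upsilon> K\<close> is \<open>diag(\<Xi>, \<Xi>) (Z A K Z A) diag(\<Upsilon>, \<Upsilon>) K\<close>, with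
  the matrices of level \<open>k\<close> in the blocks, and it collapses to
  \<open>diag(\<Xi> K \<Upsilon> K, \<Xi> K \<Upsilon> K) J\<^sup>2 = 1\<close>; the product in the other order is similar.
\<close>

section \<open>Compositions and refinement\<close>

lemma composition_Nil [simp]: "composition []"
  and composition_Cons [simp]: "composition (n # \<alpha>) \<longleftrightarrow> 0 < n \<and> composition \<alpha>"
  by (auto simp: composition_def)

lemma composition_snoc [simp]: "composition (\<alpha> @ [n]) \<longleftrightarrow> composition \<alpha> \<and> 0 < n"
  by (auto simp: composition_def)

lemma sum_comps_less_Cons:
  assumes "0 < k"
  shows "(\<Sum>\<alpha>\<in>comps_less k. f \<alpha>) =
    f [] + (\<Sum>m=1..<k. \<Sum>\<alpha>\<in>comps_less (k - m). f (m # \<alpha>))"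
proof -
  have eq: "comps_less k = insert [] (\<Union>m\<in>{1..<k}. Cons m ` comps_less (k - m))"
  proof (intro set_eqI)
    fix \<alpha> show "\<alpha> \<in> comps_less k \<longleftrightarrow> \<alpha> \<in> insert [] (\<Union>m\<in>{1..<k}. Cons m ` comps_less (k - m))"
      using assms by (cases \<alpha>) (auto simp: comps_less_def image_iff intro!: bexI)
  qed
  have "(\<Sum>\<alpha>\<in>(\<Union>m\<in>{1..<k}. Cons m ` comps_less (k - m)). f \<alpha>) =
      (\<Sum>m=1..<k. \<Sum>\<alpha>\<in>Cons m ` comps_less (k - m). f \<alpha>)"
    by (rule sum.UNION_disjoint) (auto simp: finite_comps_less)
  then show ?thesis
    unfolding eq
    by (subst sum.insert) (auto simp: finite_comps_less sum.reindex)
qed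

lemma coarsens_Nil: "coarsens [] \<beta> \<longleftrightarrow> \<beta> = []"
  by (auto simp: coarsens_def)

lemma coarsens_Cons_Nil: "\<not> coarsens (n # \<alpha>) []"
  by (auto simp: coarsens_def)

lemma coarsens_sum: "coarsens \<alpha> \<beta> \<Longrightarrow> sum_list \<alpha> = sum_list \<beta>"
  by (simp add: coarsens_def)

lemma coarsensI:
  assumes "[] \<notin> set bs"
  shows "coarsens (map sum_list bs) (concat bs)"
proof -
  have "sum_list (map sum_list bs) = sum_list (concat bs)"
    by (induction bs) simp_all
  with assms show ?thesis unfolding coarsens_def by metis
qed

lemma coarsensE:
  assumes "coarsens \<alpha> \<beta>"
  obtains bs where "[] \<notin> set bs" "concat bs = \<beta>" "map sum_list bs = \<alpha>"
  using assms unfolding coarsens_def by metis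

text \<open>
  The alternatives distinguish whether the block of the finer composition that adds up to \<open>n\<close>
  consists of \<open>m\<close> alone. Positivity of \<open>\<beta>\<close> makes a longer block strictly larger than \<open>m\<close>.
\<close>

lemma coarsens_Cons_Cons:
  assumes "composition \<beta>"
  shows "coarsens (n # \<alpha>) (m # \<beta>) \<longleftrightarrow>
    m = n \<and> coarsens \<alpha> \<beta> \<or> m < n \<and> coarsens ((n - m) # \<alpha>) \<beta>"
proof
  assume *: "coarsens (n # \<alpha>) (m # \<beta>)"
  obtain bs where bs: "[] \<notin> set bs" "concat bs = m # \<beta>" "map sum_list bs = n # \<alpha>"
    using * by (rule coarsensE)
  obtain b0 cs where b0: "bs = b0 # cs"
    using bs(3) by auto
  obtain b where b: "bs = (m # b) # cs"
    using bs(1,2) b0 by (cases b0) auto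
  have parts: "[] \<notin> set cs" "b @ concat cs = \<beta>" "n = m + sum_list b" "\<alpha> = map sum_list cs"
    using bs by (simp_all add: b)
  show "m = n \<and> coarsens \<alpha> \<beta> \<or> m < n \<and> coarsens ((n - m) # \<alpha>) \<beta>"
  proof (cases "b = []")
    case True
    with coarsensI[OF parts(1)] parts show ?thesis by simp
  next
    case False
    have "0 < sum_list b"
      using assms parts(2) False by (cases b) auto
    moreover have "[] \<notin> set (b # cs)"
      using parts(1) False by simp
    note coarsensI[OF this]
    ultimately show ?thesis using parts by simp
  qed
next
  assume "m = n \<and> coarsens \<alpha> \<beta> \<or> m < n \<and> coarsens ((n - m) # \<alpha>) \<beta>"
  then consider "m = n" "coarsens \<alpha> \<beta>" | "m < n" "coarsens ((n - m) # \<alpha>) \<beta>" by blast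
  then show "coarsens (n # \<alpha>) (m # \<beta>)"
  proof cases
    case 1
    from 1(2) obtain bs where bs: "[] \<notin> set bs" "concat bs = \<beta>" "map sum_list bs = \<alpha>"
      by (rule coarsensE)
    then show ?thesis using coarsensI[of "[m] # bs"] 1 by simp
  next
    case 2
    from 2(2) obtain bs where bs: "[] \<notin> set bs" "concat bs = \<beta>"
        "map sum_list bs = (n - m) # \<alpha>"
      by (rule coarsensE)
    then obtain b cs where "bs = b # cs" by (cases bs) auto
    then show ?thesis using coarsensI[of "(m # b) # cs"] 2 bs by simp
  qed
qed

lemma coarsens_snoc:
  "coarsens (\<alpha> @ [x]) \<beta> \<longleftrightarrow> (\<exists>\<gamma> \<delta>. \<beta> = \<gamma> @ \<delta> \<and> \<delta> \<noteq> [] \<and> sum_list \<delta> = x \<and> coarsens \<alpha> \<gamma>)"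
proof
  assume *: "coarsens (\<alpha> @ [x]) \<beta>"
  obtain bs where bs: "[] \<notin> set bs" "concat bs = \<beta>" "map sum_list bs = \<alpha> @ [x]"
    using * by (rule coarsensE)
  then obtain cs c where c: "bs = cs @ [c]"
    by (cases bs rule: rev_cases) auto
  then have "\<beta> = concat cs @ c" "c \<noteq> []" "sum_list c = x" "[] \<notin> set cs" "map sum_list cs = \<alpha>"
    using bs by auto
  then show "\<exists>\<gamma> \<delta>. \<beta> = \<gamma> @ \<delta> \<and> \<delta> \<noteq> [] \<and> sum_list \<delta> = x \<and> coarsens \<alpha> \<gamma>"
    using coarsensI[of cs] by blast
next
  assume "\<exists>\<gamma> \<delta>. \<beta> = \<gamma> @ \<delta> \<and> \<delta> \<noteq> [] \<and> sum_list \<delta> = x \<and> coarsens \<alpha> \<gamma>"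
  then obtain \<gamma> \<delta> where \<gamma>: "\<beta> = \<gamma> @ \<delta>" "\<delta> \<noteq> []" "sum_list \<delta> = x" "coarsens \<alpha> \<gamma>" by blast
  from \<gamma>(4) obtain bs where "[] \<notin> set bs" "concat bs = \<gamma>" "map sum_list bs = \<alpha>"
    by (rule coarsensE)
  then show "coarsens (\<alpha> @ [x]) \<beta>"
    using coarsensI[of "bs @ [\<delta>]"] \<gamma> by simp
qed

section \<open>The matrix of multiplication by a product of one-variable series\<close>

text \<open>
  The entry at \<open>\<alpha>, \<beta>\<close> is the coefficient of \<open>X\<^sub>1^\<alpha>\<^sub>1 X\<^sub>2^\<alpha>\<^sub>2 \<dots>\<close> in
  \<open>w(X\<^sub>1) w(X\<^sub>2) \<dots> p\<^sup>\<beta>\<close>, where \<open>w(X) = \<Sum>\<^sub>s w\<^sub>s X\<^sup>s\<close>: the first variable either stays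
  out of the monomial of \<open>p\<^sup>\<beta>\<close> or carries the first part of \<open>\<beta>\<close>. The parts of \<open>\<alpha>\<close> may be zero,
  which allows exponent vectors as arguments.
\<close>

primrec mul_mat :: "(nat \<Rightarrow> laurent) \<Rightarrow> mat" where
  "mul_mat w [] \<beta> = (if \<beta> = [] then 1 else 0)"
| "mul_mat w (n # \<alpha>) \<beta> = w n * mul_mat w \<alpha> \<beta> +
     (case \<beta> of [] \<Rightarrow> 0 | m # \<gamma> \<Rightarrow> if m \<le> n then w (n - m) * mul_mat w \<alpha> \<gamma> else 0)"

text \<open>
  The same alternative for the last variable. Polynomials in \<open>m + 1\<close> variables are built from
  polynomials in the first \<open>m\<close>, so this is the form that their coefficients obey.
\<close>

lemma mul_mat_snoc:
  "mul_mat w (\<alpha> @ [n]) \<beta> = w n * mul_mat w \<alpha> \<beta> +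
    (if \<beta> \<noteq> [] \<and> last \<beta> \<le> n then w (n - last \<beta>) * mul_mat w \<alpha> (butlast \<beta>) else 0)"
proof (induction \<alpha> arbitrary: \<beta>)
  case Nil
  show ?case by (cases \<beta>) auto
next
  case (Cons a \<alpha>)
  show ?case
  proof (cases \<beta>)
    case Nil
    then show ?thesis by (simp add: Cons.IH)
  next
    case (Cons m \<gamma>)
    then show ?thesis
      by (cases "\<gamma> = []") (simp_all add: Cons.IH distrib_left mult.left_commute)
  qed
qed

text \<open>
  A variable with exponent zero contributes \<open>w\<^sub>0 = 1\<close>; this is the quasi-symmetry of the product.
\<close>

lemma mul_mat_filter_pos:
  assumes "w 0 = 1" "composition \<beta>"
  shows "mul_mat w (filter (\<lambda>x. 0 < x) \<alpha>) \<beta> = mul_mat w \<alpha> \<beta>"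
  using assms(2) by (induction \<alpha> arbitrary: \<beta>) (auto simp: assms(1) split: list.split)

lemma mul_mat_eq_0: "sum_list \<alpha> < sum_list \<beta> \<Longrightarrow> mul_mat w \<alpha> \<beta> = 0"
  by (induction \<alpha> arbitrary: \<beta>) (auto split: list.split)

section \<open>Coefficients of quasi-symmetric polynomials\<close>

definition exps :: "nat \<Rightarrow> (nat \<Rightarrow>\<^sub>0 nat) \<Rightarrow> nat list" where
  "exps m e = map (Poly_Mapping.lookup e) [1..<Suc m]"

lemma exps_0 [simp]: "exps 0 e = []"
  and exps_Suc [simp]: "exps (Suc m) e = exps m e @ [Poly_Mapping.lookup e (Suc m)]"
  by (simp_all add: exps_def)

text \<open>
  Coefficients of a polynomial in \<open>X\<^sub>1, \<dots>, X\<^sub>m\<close> vanish at monomials with other variables. After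
  multiplication by the power \<open>s\<close> of the new variable, only monomials in which that variable
  has exponent exactly \<open>s\<close> remain.
\<close>

lemma keys_remove_var_subset:
  fixes e :: "nat \<Rightarrow>\<^sub>0 nat"
  assumes "s \<le> Poly_Mapping.lookup e (Suc m)"
  shows "Poly_Mapping.keys (e - Poly_Mapping.single (Suc m) s) \<subseteq> {1..m} \<longleftrightarrow>
    Poly_Mapping.keys e \<subseteq> {1..Suc m} \<and> s = Poly_Mapping.lookup e (Suc m)"
  (is "?L \<longleftrightarrow> ?R")
proof -
  have lookup: "Poly_Mapping.lookup (e - Poly_Mapping.single (Suc m) s) i =
      (if i = Suc m then Poly_Mapping.lookup e i - s else Poly_Mapping.lookup e i)" for i
    by (simp add: lookup_minus lookup_single when_def)
  show ?thesis
  proof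
    assume ?L
    then have *: "i \<in> {1..m}" if "Poly_Mapping.lookup (e - Poly_Mapping.single (Suc m) s) i \<noteq> 0" for i
      using that by (metis in_keys_iff subsetD)
    have "Poly_Mapping.lookup (e - Poly_Mapping.single (Suc m) s) (Suc m) = 0"
    proof (rule ccontr)
      assume "Poly_Mapping.lookup (e - Poly_Mapping.single (Suc m) s) (Suc m) \<noteq> 0"
      from *[OF this] show False by simp
    qed
    then have "s = Poly_Mapping.lookup e (Suc m)"
      using assms by (simp add: lookup)
    moreover have "i \<in> {1..Suc m}" if "i \<in> Poly_Mapping.keys e" for i
      using *[of i] that by (cases "i = Suc m") (auto simp: lookup in_keys_iff)
    ultimately show ?R by blast
  next
    assume R: ?R
    have "i \<in> {1..m}" if "i \<in> Poly_Mapping.keys (e - Poly_Mapping.single (Suc m) s)" for i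
    proof -
      have "Poly_Mapping.lookup (e - Poly_Mapping.single (Suc m) s) i \<noteq> 0"
        using that by (metis in_keys_iff)
      then have "i \<noteq> Suc m" "i \<in> Poly_Mapping.keys e"
        using lookup[of i] R by (auto simp: in_keys_iff split: if_splits)
      moreover have "i \<in> {1..Suc m}" using R \<open>i \<in> Poly_Mapping.keys e\<close> by blast
      ultimately show ?thesis by auto
    qed
    then show ?L by blast
  qed
qed

lemma exps_remove_var [simp]: "exps m (e - Poly_Mapping.single (Suc m) s) = exps m e"
  by (auto simp: exps_def lookup_minus lookup_single when_def simp del: upt_Suc)

definition inc_lists :: "nat \<Rightarrow> nat \<Rightarrow> nat list set" where
  "inc_lists m l = {is. length is = l \<and> sorted_wrt (<) is \<and> set is \<subseteq> {1..m}}"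

lemma finite_inc_lists: "finite (inc_lists m l)"
proof (rule finite_subset)
  show "inc_lists m l \<subseteq> {xs. set xs \<subseteq> {1..m} \<and> length xs = l}"
    by (auto simp: inc_lists_def)
qed (rule finite_lists_length_eq, simp)

lemma inc_lists_Suc:
  "inc_lists (Suc m) (Suc l) = inc_lists m (Suc l) \<union> (\<lambda>is. is @ [Suc m]) ` inc_lists m l"
proof (intro equalityI subsetI)
  fix xs assume xs: "xs \<in> inc_lists (Suc m) (Suc l)"
  then obtain ys i where i: "xs = ys @ [i]"
    by (cases xs rule: rev_cases) (auto simp: inc_lists_def)
  have *: "length ys = l" "sorted_wrt (<) ys" "\<And>y. y \<in> set ys \<Longrightarrow> y < i"
      "\<And>y. y \<in> set ys \<Longrightarrow> 1 \<le> y" "1 \<le> i" "i \<le> Suc m"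
    using xs by (auto simp: inc_lists_def i sorted_wrt_append)
  have "y \<in> {1..m}" if "y \<in> set ys" for y
    using *(3,4)[OF that] *(6) by simp
  then have ys: "ys \<in> inc_lists m l"
    using *(1,2) by (auto simp: inc_lists_def)
  show "xs \<in> inc_lists m (Suc l) \<union> (\<lambda>is. is @ [Suc m]) ` inc_lists m l"
  proof (cases "i = Suc m")
    case True
    then show ?thesis using ys i by blast
  next
    case False
    then have "xs \<in> inc_lists m (Suc l)"
      using * ys by (simp add: inc_lists_def i sorted_wrt_append)
    then show ?thesis ..
  qed
next
  have sub: "{1..m} \<subseteq> {1..Suc m}" by simp
  fix xs assume "xs \<in> inc_lists m (Suc l) \<union> (\<lambda>is. is @ [Suc m]) ` inc_lists m l"
  then consider "xs \<in> inc_lists m (Suc l)" | ys where "ys \<in> inc_lists m l" "xs = ys @ [Suc m]"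
    by blast
  then show "xs \<in> inc_lists (Suc m) (Suc l)"
  proof cases
    case 1
    then show ?thesis using sub unfolding inc_lists_def by blast
  next
    case 2
    then have "set ys \<subseteq> {1..m}" by (simp add: inc_lists_def)
    then have "\<forall>y\<in>set ys. 1 \<le> y \<and> y < Suc m" by force
    then show ?thesis using 2 by (auto simp: inc_lists_def sorted_wrt_append)
  qed
qed

lemma qsym_p_inc_lists:
  "qsym_p m \<beta> = (\<Sum>is\<in>inc_lists m (length \<beta>). \<Prod>j<length \<beta>. X (is ! j) ^ (\<beta> ! j))"
  by (simp add: qsym_p_def inc_lists_def)

lemma qsym_p_Nil: "qsym_p m [] = 1"
proof -
  have "inc_lists m 0 = {[]}" by (auto simp: inc_lists_def)
  then show ?thesis by (simp add: qsym_p_inc_lists)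
qed

lemma qsym_p_0: "\<beta> \<noteq> [] \<Longrightarrow> qsym_p 0 \<beta> = 0"
proof -
  assume "\<beta> \<noteq> []"
  then have "inc_lists 0 (length \<beta>) = {}" by (auto simp: inc_lists_def)
  then show ?thesis by (simp add: qsym_p_inc_lists)
qed

lemma qsym_p_snoc:
  "qsym_p (Suc m) (\<beta> @ [b]) = qsym_p m (\<beta> @ [b]) + qsym_p m \<beta> * X (Suc m) ^ b"
proof -
  let ?t = "\<lambda>is. \<Prod>j<length (\<beta> @ [b]). X (is ! j) ^ ((\<beta> @ [b]) ! j)"
  let ?J = "(\<lambda>is. is @ [Suc m]) ` inc_lists m (length \<beta>)"
  have "inc_lists m (Suc (length \<beta>)) \<inter> ?J = {}"
    by (auto simp: inc_lists_def)
  then have "qsym_p (Suc m) (\<beta> @ [b]) = qsym_p m (\<beta> @ [b]) + sum ?t ?J"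
    unfolding qsym_p_inc_lists
    by (simp add: inc_lists_Suc sum.union_disjoint finite_inc_lists del: prod.lessThan_Suc)
  also have "sum ?t ?J = (\<Sum>is\<in>inc_lists m (length \<beta>). ?t (is @ [Suc m]))"
    by (subst sum.reindex) (auto simp: inj_on_def)
  also have "\<dots> = qsym_p m \<beta> * X (Suc m) ^ b"
    unfolding qsym_p_inc_lists sum_distrib_right
  proof (rule sum.cong)
    fix xs assume "xs \<in> inc_lists m (length \<beta>)"
    then have "length xs = length \<beta>" by (simp add: inc_lists_def)
    then show "?t (xs @ [Suc m]) = (\<Prod>j<length \<beta>. X (xs ! j) ^ (\<beta> ! j)) * X (Suc m) ^ b"
      by (simp add: nth_append)
  qed simp
  finally show ?thesis .
qed

lemma lookup_qsym_p:
  assumes "composition \<beta>"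
  shows "Poly_Mapping.lookup (qsym_p m \<beta>) e =
    (if Poly_Mapping.keys e \<subseteq> {1..m} \<and> filter (\<lambda>x. 0 < x) (exps m e) = \<beta> then 1 else 0)"
  using assms
proof (induction m arbitrary: \<beta> e)
  case 0
  show ?case
    by (cases "\<beta> = []") (auto simp: qsym_p_Nil qsym_p_0 lookup_one when_def)
next
  case (Suc m)
  let ?n = "Poly_Mapping.lookup e (Suc m)"
  define K where "K \<longleftrightarrow> Poly_Mapping.keys e \<subseteq> {1..Suc m}"
  have keys: "Poly_Mapping.keys (e - Poly_Mapping.single (Suc m) s) \<subseteq> {1..m} \<longleftrightarrow> K \<and> s = ?n"
    if "s \<le> ?n" for s
    unfolding K_def by (rule keys_remove_var_subset[OF that])
  have keys_0: "Poly_Mapping.keys e \<subseteq> {1..m} \<longleftrightarrow> K \<and> 0 = ?n"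
    using keys[of 0] by simp
  show ?case
  proof (cases \<beta> rule: rev_cases)
    case Nil
    have "Poly_Mapping.lookup (qsym_p (Suc m) []) e =
        (if K \<and> 0 = ?n \<and> filter (\<lambda>x. 0 < x) (exps m e) = [] then 1 else 0)"
      using Suc.IH[of "[]" e] unfolding keys_0 by (simp add: qsym_p_Nil)
    then show ?thesis
      unfolding Nil K_def[symmetric] by auto
  next
    case (snoc \<gamma> b)
    with Suc.prems have b: "composition \<gamma>" "0 < b" by simp_all
    have "Poly_Mapping.lookup (qsym_p (Suc m) \<beta>) e = Poly_Mapping.lookup (qsym_p m \<beta>) e +
        (if b \<le> ?n then Poly_Mapping.lookup (qsym_p m \<gamma>) (e - Poly_Mapping.single (Suc m) b) else 0)"
      by (simp add: snoc qsym_p_snoc lookup_add X_power lookup_mult_single_var)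
    also have "Poly_Mapping.lookup (qsym_p m \<beta>) e =
        (if K \<and> 0 = ?n \<and> filter (\<lambda>x. 0 < x) (exps m e) = \<beta> then 1 else 0)"
      unfolding Suc.IH[OF Suc.prems] keys_0 by simp
    also have "(if b \<le> ?n then Poly_Mapping.lookup (qsym_p m \<gamma>)
          (e - Poly_Mapping.single (Suc m) b) else 0) =
        (if K \<and> b = ?n \<and> filter (\<lambda>x. 0 < x) (exps m e) = \<gamma> then 1 else 0)"
      using keys[of b] unfolding Suc.IH[OF b(1)] by (cases "b \<le> ?n") (simp_all only: exps_remove_var, auto)
    also have "(if K \<and> 0 = ?n \<and> filter (\<lambda>x. 0 < x) (exps m e) = \<beta> then 1 else 0) +
        (if K \<and> b = ?n \<and> filter (\<lambda>x. 0 < x) (exps m e) = \<gamma> then 1 else 0) =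
        (if K \<and> filter (\<lambda>x. 0 < x) (exps (Suc m) e) = \<beta> then 1 else (0::laurent))"
      using b by (auto simp: snoc)
    finally show ?thesis unfolding K_def .
  qed
qed

lemma a_comp_Suc:
  "a_comp (Suc m) d = (\<Sum>s=0..d. a_comp m (d - s) *
     Poly_Mapping.single (Poly_Mapping.single (Suc m) s) (\<aa> s))"
proof -
  have "(\<Prod>i\<in>{1..Suc m}. a_series i) = a_series (Suc m) * (\<Prod>i\<in>{1..m}. a_series i)"
    by (simp add: prod.nat_ivl_Suc')
  then show ?thesis
    by (simp only: a_comp_def fps_mult_nth)
      (simp add: a_series_def const_def X_power mult_single mult.commute)
qed

lemma lookup_a_comp_qsym_p:
  assumes "composition \<beta>"
  shows "Poly_Mapping.lookup (a_comp m d * qsym_p m \<beta>) e =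
    (if Poly_Mapping.keys e \<subseteq> {1..m} \<and> sum_list (exps m e) = d + sum_list \<beta>
     then mul_mat \<aa> (exps m e) \<beta> else 0)"
  using assms
proof (induction m arbitrary: d \<beta> e)
  case 0
  have "a_comp 0 d = (if d = 0 then 1 else 0)"
    by (simp add: a_comp_def)
  then show ?case
    by (cases "\<beta> = []") (auto simp: qsym_p_Nil qsym_p_0 lookup_one when_def)
next
  case (Suc m)
  define n where "n = Poly_Mapping.lookup e (Suc m)"
  define S where "S = sum_list (exps m e)"
  let ?M = "\<lambda>s. Poly_Mapping.single (Poly_Mapping.single (Suc m) s)"
  define K where "K \<longleftrightarrow> Poly_Mapping.keys e \<subseteq> {1..Suc m}"
  have keys: "Poly_Mapping.keys (e - Poly_Mapping.single (Suc m) s) \<subseteq> {1..m} \<longleftrightarrow> K \<and> s = n"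
    if "s \<le> n" for s
    using that unfolding K_def n_def by (rule keys_remove_var_subset)
  have coeff: "Poly_Mapping.lookup (\<Sum>s=0..d. (a_comp m (d - s) * qsym_p m \<gamma>) * ?M (s + b) (\<aa> s)) e =
      (if K \<and> b \<le> n \<and> S + n = d + b + sum_list \<gamma>
       then \<aa> (n - b) * mul_mat \<aa> (exps m e) \<gamma> else 0)"
    if \<gamma>: "composition \<gamma>" for \<gamma> b
  proof -
    have "Poly_Mapping.lookup (\<Sum>s=0..d. (a_comp m (d - s) * qsym_p m \<gamma>) * ?M (s + b) (\<aa> s)) e =
        (\<Sum>s=0..d. if s + b \<le> n then Poly_Mapping.lookup (a_comp m (d - s) * qsym_p m \<gamma>)
          (e - Poly_Mapping.single (Suc m) (s + b)) * \<aa> s else 0)"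
      by (simp only: lookup_sum lookup_mult_single_var n_def)
    also have "\<dots> = (\<Sum>s=0..d. if s = n - b then
        (if K \<and> b \<le> n \<and> S = d - s + sum_list \<gamma> then \<aa> s * mul_mat \<aa> (exps m e) \<gamma> else 0) else 0)"
    proof (rule sum.cong)
      fix s
      show "(if s + b \<le> n then Poly_Mapping.lookup (a_comp m (d - s) * qsym_p m \<gamma>)
          (e - Poly_Mapping.single (Suc m) (s + b)) * \<aa> s else 0) = (if s = n - b then
        (if K \<and> b \<le> n \<and> S = d - s + sum_list \<gamma> then \<aa> s * mul_mat \<aa> (exps m e) \<gamma> else 0) else 0)"
      proof (cases "s + b \<le> n")
        case True
        show ?thesis
          unfolding Suc.IH[OF \<gamma>] keys[OF True] exps_remove_var S_def[symmetric]
          using True by (cases "s + b = n") (simp_all, linarith)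
      qed auto
    qed simp
    also have "\<dots> = (if n - b \<le> d then
        (if K \<and> b \<le> n \<and> S = d - (n - b) + sum_list \<gamma>
         then \<aa> (n - b) * mul_mat \<aa> (exps m e) \<gamma> else 0) else 0)"
      by (simp add: sum.delta)
    \<comment> \<open>The differences are truncated; where this matters, \<open>exps m e\<close> has smaller size than
      \<open>\<gamma>\<close>, and the entry of \<open>mul_mat\<close> is zero.\<close>
    also have "\<dots> = (if K \<and> b \<le> n \<and> S + n = d + b + sum_list \<gamma>
       then \<aa> (n - b) * mul_mat \<aa> (exps m e) \<gamma> else 0)"
      using mul_mat_eq_0[of "exps m e" \<gamma> \<aa>, folded S_def]
      by (cases "n \<le> d + b"; cases "S < sum_list \<gamma>") auto
    finally show ?thesis .
  qed
  have split: "a_comp (Suc m) d * qsym_p m \<gamma> * X (Suc m) ^ b =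
      (\<Sum>s=0..d. (a_comp m (d - s) * qsym_p m \<gamma>) * ?M (s + b) (\<aa> s))" for \<gamma> b
  proof -
    have M: "?M (s + b) (\<aa> s) = ?M s (\<aa> s) * X (Suc m) ^ b" for s
      by (simp add: X_power mult_single single_add)
    show ?thesis
      unfolding a_comp_Suc M sum_distrib_right by (simp add: mult_ac)
  qed
  have no_var: "Poly_Mapping.lookup (a_comp (Suc m) d * qsym_p m \<beta>) e =
      (if K \<and> S + n = d + sum_list \<beta> then \<aa> n * mul_mat \<aa> (exps m e) \<beta> else 0)"
    using split[of \<beta> 0] coeff[OF Suc.prems, of 0] by simp
  have "Poly_Mapping.lookup (a_comp (Suc m) d * qsym_p (Suc m) \<beta>) e =
      (if K \<and> S + n = d + sum_list \<beta> then \<aa> n * mul_mat \<aa> (exps m e) \<beta> else 0) +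
      (if \<beta> = [] then 0 else if K \<and> last \<beta> \<le> n \<and> S + n = d + last \<beta> + sum_list (butlast \<beta>)
       then \<aa> (n - last \<beta>) * mul_mat \<aa> (exps m e) (butlast \<beta>) else 0)"
  proof (cases \<beta> rule: rev_cases)
    case Nil
    then show ?thesis using no_var by (simp add: qsym_p_Nil)
  next
    case (snoc \<gamma> b)
    then have "composition \<gamma>" using Suc.prems by simp
    from coeff[OF this, of b] show ?thesis
      unfolding snoc qsym_p_snoc distrib_left lookup_add mult.assoc[symmetric] split
        no_var[unfolded snoc]
      by simp
  qed
  also have "\<dots> = (if K \<and> sum_list (exps (Suc m) e) = d + sum_list \<beta>
      then mul_mat \<aa> (exps (Suc m) e) \<beta> else 0)"
    by (cases \<beta> rule: rev_cases) (auto simp: mul_mat_snoc add_ac n_def S_def)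
  finally show ?case unfolding K_def .
qed

lemma lookup_const_mult: "Poly_Mapping.lookup (const c * f) e = c * Poly_Mapping.lookup f e"
  using lookup_mult_single_var[of f undefined 0 c e]
  by (simp add: const_def mult.commute)

text \<open>
  The monomial \<open>X\<^sub>1^\<nu>\<^sub>1 X\<^sub>2^\<nu>\<^sub>2 \<dots>\<close> occurs in \<open>p\<^sup>\<nu>\<close> and in no other \<open>p\<^sup>\<mu>\<close>, so it
  reads off the coefficient of \<open>p\<^sup>\<nu>\<close> in any expansion.
\<close>

definition seq_monomial :: "nat list \<Rightarrow> (nat \<Rightarrow>\<^sub>0 nat)" where
  "seq_monomial \<nu> = (\<Sum>j<length \<nu>. Poly_Mapping.single (Suc j) (\<nu> ! j))"

lemma lookup_seq_monomial:
  "Poly_Mapping.lookup (seq_monomial \<nu>) i = (if 1 \<le> i \<and> i \<le> length \<nu> then \<nu> ! (i - 1) else 0)"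
proof -
  have "Poly_Mapping.lookup (seq_monomial \<nu>) i =
      (\<Sum>j<length \<nu>. if j = i - 1 then (if 1 \<le> i then \<nu> ! (i - 1) else 0) else 0)"
    unfolding seq_monomial_def lookup_sum
    by (rule sum.cong) (auto simp: lookup_single when_def)
  then show ?thesis by (auto simp: sum.delta)
qed

lemma keys_seq_monomial: "length \<nu> \<le> m \<Longrightarrow> Poly_Mapping.keys (seq_monomial \<nu>) \<subseteq> {1..m}"
  by (auto simp: in_keys_iff lookup_seq_monomial split: if_splits)

lemma filter_exps_seq_monomial:
  assumes "composition \<nu>" "length \<nu> \<le> m"
  shows "filter (\<lambda>x. 0 < x) (exps m (seq_monomial \<nu>)) = \<nu>"
proof -
  have "exps m (seq_monomial \<nu>) = \<nu> @ replicate (m - length \<nu>) 0"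
    by (rule nth_equalityI)
      (use assms in \<open>auto simp: exps_def lookup_seq_monomial nth_append simp del: upt_Suc\<close>)
  then show ?thesis using assms(1) by (simp add: composition_def)
qed

lemma qsym_coeffs_eqI:
  assumes "Poly_Mapping.keys c \<subseteq> {\<nu>. composition \<nu> \<and> length \<nu> \<le> m}"
    "f = (\<Sum>\<nu>\<in>Poly_Mapping.keys c. const (Poly_Mapping.lookup c \<nu>) * qsym_p m \<nu>)"
  shows "qsym_coeffs m f = c"
proof -
  have coeff: "Poly_Mapping.lookup c' \<alpha> = Poly_Mapping.lookup f (seq_monomial \<alpha>)"
    if c': "Poly_Mapping.keys c' \<subseteq> {\<nu>. composition \<nu> \<and> length \<nu> \<le> m}"
      "f = (\<Sum>\<nu>\<in>Poly_Mapping.keys c'. const (Poly_Mapping.lookup c' \<nu>) * qsym_p m \<nu>)"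
      and \<alpha>: "composition \<alpha>" "length \<alpha> \<le> m" for c' \<alpha>
  proof -
    have "Poly_Mapping.lookup f (seq_monomial \<alpha>) = (\<Sum>\<nu>\<in>Poly_Mapping.keys c'.
        Poly_Mapping.lookup c' \<nu> * Poly_Mapping.lookup (qsym_p m \<nu>) (seq_monomial \<alpha>))"
      by (subst c'(2)) (simp add: lookup_sum lookup_const_mult)
    also have "\<dots> = (\<Sum>\<nu>\<in>Poly_Mapping.keys c'. if \<nu> = \<alpha> then Poly_Mapping.lookup c' \<nu> else 0)"
    proof (rule sum.cong)
      fix \<nu> assume "\<nu> \<in> Poly_Mapping.keys c'"
      with c'(1) have "composition \<nu>" by blast
      then have "Poly_Mapping.lookup (qsym_p m \<nu>) (seq_monomial \<alpha>) = (if \<alpha> = \<nu> then 1 else 0)"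
        using keys_seq_monomial[OF \<alpha>(2)]
        by (simp only: lookup_qsym_p filter_exps_seq_monomial[OF \<alpha>] simp_thms)
      then show "Poly_Mapping.lookup c' \<nu> * Poly_Mapping.lookup (qsym_p m \<nu>) (seq_monomial \<alpha>) =
          (if \<nu> = \<alpha> then Poly_Mapping.lookup c' \<nu> else 0)"
        by simp
    qed simp
    also have "\<dots> = Poly_Mapping.lookup c' \<alpha>"
      by (simp add: sum.delta in_keys_iff)
    finally show ?thesis ..
  qed
  show ?thesis
    unfolding qsym_coeffs_def
  proof (rule the_equality)
    fix c' assume c': "Poly_Mapping.keys c' \<subseteq> {\<nu>. composition \<nu> \<and> length \<nu> \<le> m} \<and>
      f = (\<Sum>\<nu>\<in>Poly_Mapping.keys c'. const (Poly_Mapping.lookup c' \<nu>) * qsym_p m \<nu>)"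
    show "c' = c"
    proof (rule poly_mapping_eqI)
      fix \<alpha>
      show "Poly_Mapping.lookup c' \<alpha> = Poly_Mapping.lookup c \<alpha>"
      proof (cases "composition \<alpha> \<and> length \<alpha> \<le> m")
        case True
        then show ?thesis using coeff[of c' \<alpha>] coeff[of c \<alpha>] c' assms by simp
      next
        case False
        then have "\<alpha> \<notin> Poly_Mapping.keys c'" "\<alpha> \<notin> Poly_Mapping.keys c"
          using c' assms(1) by blast+
        then show ?thesis by (simp add: in_keys_iff)
      qed
    qed
  qed (use assms in blast)
qed

lemma \<aa>_0 [simp]: "\<aa> 0 = 1"
  by (simp add: \<aa>_def)

text \<open>
  The coefficient of a monomial in \<open>a\<^sub>d p\<^sup>\<beta>\<close> depends only on the sequence \<open>\<nu>\<close> of its nonzero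
  exponents, and the monomials with a given \<open>\<nu>\<close> are exactly those of \<open>p\<^sup>\<nu>\<close>.
\<close>

lemma lookup_qsym_coeffs:
  assumes "composition \<alpha>" "length \<alpha> \<le> m" "composition \<beta>" "sum_list \<alpha> = d + sum_list \<beta>"
  shows "Poly_Mapping.lookup (qsym_coeffs m (a_comp m d * qsym_p m \<beta>)) \<alpha> = mul_mat \<aa> \<alpha> \<beta>"
proof -
  define N where "N = {\<nu>\<in>comps_less (Suc (d + sum_list \<beta>)).
    sum_list \<nu> = d + sum_list \<beta> \<and> length \<nu> \<le> m}"
  define c where "c = (\<Sum>\<nu>\<in>N. Poly_Mapping.single \<nu> (mul_mat \<aa> \<nu> \<beta>))"
  have fin: "finite N" by (simp add: N_def finite_comps_less)
  have N: "\<nu> \<in> N \<longleftrightarrow> composition \<nu> \<and> length \<nu> \<le> m \<and> sum_list \<nu> = d + sum_list \<beta>" for \<nu>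
    by (auto simp: N_def comps_less_def)
  have c: "Poly_Mapping.lookup c \<nu> = (if \<nu> \<in> N then mul_mat \<aa> \<nu> \<beta> else 0)" for \<nu>
    using fin by (simp add: c_def lookup_sum lookup_single when_def sum.delta)
  have keys: "Poly_Mapping.keys c \<subseteq> N"
    by (auto simp: in_keys_iff c split: if_splits)
  have "qsym_coeffs m (a_comp m d * qsym_p m \<beta>) = c"
  proof (rule qsym_coeffs_eqI)
    show "Poly_Mapping.keys c \<subseteq> {\<nu>. composition \<nu> \<and> length \<nu> \<le> m}"
      using keys N by blast
    have "a_comp m d * qsym_p m \<beta> = (\<Sum>\<nu>\<in>N. const (Poly_Mapping.lookup c \<nu>) * qsym_p m \<nu>)"
    proof (rule poly_mapping_eqI)
      fix e :: "nat \<Rightarrow>\<^sub>0 nat"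
      define K where "K \<longleftrightarrow> Poly_Mapping.keys e \<subseteq> {1..m}"
      let ?\<nu> = "filter (\<lambda>x. 0 < x) (exps m e)"
      have sum: "sum_list ?\<nu> = sum_list (exps m e)"
        using sum_list_map_filter[of "exps m e" "\<lambda>x. 0 < x" id] by simp
      have len: "length ?\<nu> \<le> m"
        by (rule order_trans[OF length_filter_le]) (simp add: exps_def)
      have comp: "composition ?\<nu>" by (auto simp: composition_def)
      have lookup_p: "Poly_Mapping.lookup (qsym_p m \<nu>) e = (if K \<and> ?\<nu> = \<nu> then 1 else 0)"
        if "\<nu> \<in> N" for \<nu>
        using that unfolding K_def N by (intro lookup_qsym_p) simp
      have "Poly_Mapping.lookup (\<Sum>\<nu>\<in>N. const (Poly_Mapping.lookup c \<nu>) * qsym_p m \<nu>) e =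
          (\<Sum>\<nu>\<in>N. Poly_Mapping.lookup c \<nu> * Poly_Mapping.lookup (qsym_p m \<nu>) e)"
        by (simp add: lookup_sum lookup_const_mult)
      also have "\<dots> = (\<Sum>\<nu>\<in>N. if \<nu> = ?\<nu> then (if K then mul_mat \<aa> \<nu> \<beta> else 0) else 0)"
        by (intro sum.cong) (auto simp: lookup_p c)
      also have "\<dots> = (if K \<and> ?\<nu> \<in> N then mul_mat \<aa> ?\<nu> \<beta> else 0)"
        using fin by (simp add: sum.delta)
      also have "\<dots> = Poly_Mapping.lookup (a_comp m d * qsym_p m \<beta>) e"
        unfolding lookup_a_comp_qsym_p[OF assms(3)] K_def[symmetric]
        using sum len comp by (simp add: assms(3) N mul_mat_filter_pos)
      finally show "Poly_Mapping.lookup (a_comp m d * qsym_p m \<beta>) e =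
        Poly_Mapping.lookup (\<Sum>\<nu>\<in>N. const (Poly_Mapping.lookup c \<nu>) * qsym_p m \<nu>) e" ..
    qed
    also have "\<dots> = (\<Sum>\<nu>\<in>Poly_Mapping.keys c. const (Poly_Mapping.lookup c \<nu>) * qsym_p m \<nu>)"
      using fin keys by (intro sum.mono_neutral_right) (auto simp: in_keys_iff const_def)
    finally show "a_comp m d * qsym_p m \<beta> =
      (\<Sum>\<nu>\<in>Poly_Mapping.keys c. const (Poly_Mapping.lookup c \<nu>) * qsym_p m \<nu>)" .
  qed
  then show ?thesis using assms by (simp add: c N)
qed

lemma A_mat_eq_mul_mat:
  assumes "composition \<alpha>" "composition \<beta>"
  shows "A_mat \<alpha> \<beta> = mul_mat \<aa> \<alpha> \<beta>"
proof (cases "sum_list \<alpha> < sum_list \<beta>")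
  case True
  then show ?thesis by (simp add: A_mat_def mul_mat_eq_0)
next
  case False
  have *: "Poly_Mapping.lookup
      (qsym_coeffs m (a_comp m (sum_list \<alpha> - sum_list \<beta>) * qsym_p m \<beta>)) \<alpha> = mul_mat \<aa> \<alpha> \<beta>"
    if "length \<alpha> \<le> m" for m
    using that assms False by (intro lookup_qsym_coeffs) auto
  have "(THE r. \<forall>m\<ge>length \<alpha>. Poly_Mapping.lookup
      (qsym_coeffs m (a_comp m (sum_list \<alpha> - sum_list \<beta>) * qsym_p m \<beta>)) \<alpha> = r) = mul_mat \<aa> \<alpha> \<beta>"
    by (rule the_equality) (use * in auto)
  then show ?thesis using False by (simp add: A_mat_def)
qed

section \<open>Homomorphisms of the free associative algebra\<close>

text \<open>
  With concatenation as addition, the convolution algebra of finitely supported functions on lists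
  is the free associative algebra; its words are the lists of letters.
\<close>

instantiation list :: (type) monoid_add
begin
definition zero_list :: "'a list" where "0 = []"
definition plus_list :: "'a list \<Rightarrow> 'a list \<Rightarrow> 'a list" where "xs + ys = xs @ ys"
instance by standard (simp_all add: zero_list_def plus_list_def)
end

type_synonym nsym = "nat list \<Rightarrow>\<^sub>0 laurent"

definition scal :: "laurent \<Rightarrow> nsym" where
  "scal c = Poly_Mapping.single 0 c"

lemma scal_0 [simp]: "scal 0 = 0"
  and scal_1 [simp]: "scal 1 = 1"
  and scal_add: "scal (c + d) = scal c + scal d"
  and scal_uminus: "scal (- c) = - scal c"
  and scal_mult: "scal (c * d) = scal c * scal d"
  by (simp_all add: scal_def single_add single_uminus mult_single)

lemma scal_sum: "scal (sum f A) = (\<Sum>i\<in>A. scal (f i))"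
  by (induction A rule: infinite_finite_induct) (simp_all add: scal_add)

lemma scal_central: "f * scal c = scal c * f"
proof (induction f rule: update_induct)
  case (update f a b)
  have "Poly_Mapping.update a b f = f + Poly_Mapping.single a b"
    using update(1)
    by (auto simp: poly_mapping_eq_iff fun_eq_iff lookup_update lookup_add lookup_single
        when_def in_keys_iff)
  moreover have "Poly_Mapping.single a b * scal c = scal c * Poly_Mapping.single a b"
    by (simp add: scal_def mult_single mult.commute)
  ultimately show ?case
    using update by (simp add: distrib_left distrib_right)
qed simp

text \<open>
  The value of the word \<open>H\<^sub>\<alpha>\<close> after the coefficients of the series \<open>x\<close> are substituted for the
  generators. A series with constant coefficient \<open>1\<close> thus stands for the homomorphism
  \<open>H(T) \<mapsto> x(T)\<close>.
\<close>

definition ev :: "'r::ring_1 fps \<Rightarrow> nat list \<Rightarrow> 'r" where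
  "ev x \<alpha> = prod_list (map (fps_nth x) \<alpha>)"

lemma ev_Nil [simp]: "ev x [] = 1"
  and ev_Cons [simp]: "ev x (n # \<alpha>) = fps_nth x n * ev x \<alpha>"
  by (simp_all add: ev_def)

definition scal_fps :: "(nat \<Rightarrow> laurent) \<Rightarrow> nsym fps" where
  "scal_fps w = Abs_fps (\<lambda>n. scal (w n))"

lemma scal_fps_central: "f * scal_fps w = scal_fps w * f"
proof (rule fps_ext)
  fix n
  have "fps_nth (scal_fps w * f) n = (\<Sum>i=0..n. scal (w (n - i)) * fps_nth f i)"
    unfolding fps_mult_nth scal_fps_def
    by (rule sum.reindex_bij_witness[of _ "\<lambda>i. n - i" "\<lambda>i. n - i"]) auto
  then show "fps_nth (f * scal_fps w) n = fps_nth (scal_fps w * f) n"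
    by (simp add: fps_mult_nth scal_fps_def scal_central)
qed

text \<open>
  Sorting the sum by the first part \<open>m\<close> of \<open>\<beta>\<close> turns the recursion of \<open>mul_mat\<close> into the Cauchy
  product: \<open>m\<close> contributes \<open>w\<^sub>n\<^sub>-\<^sub>m x\<^sub>m\<close>, and the alternative that skips the variable
  supplies the term \<open>w\<^sub>n x\<^sub>0\<close>.
\<close>

lemma mul_mat_ev:
  assumes "composition \<alpha>" "sum_list \<alpha> < k" "fps_nth x 0 = 1"
  shows "(\<Sum>\<beta>\<in>comps_less k. scal (mul_mat w \<alpha> \<beta>) * ev x \<beta>) = ev (scal_fps w * x) \<alpha>"
  using assms(1,2)
proof (induction \<alpha> arbitrary: k)
  case Nil
  have "(\<Sum>\<beta>\<in>comps_less k. scal (mul_mat w [] \<beta>) * ev x \<beta>) =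
      (\<Sum>\<beta>\<in>comps_less k. if \<beta> = [] then 1 else 0)"
    by (rule sum.cong) auto
  also have "\<dots> = 1"
    using Nil by (subst sum_comps_less_Cons) simp_all
  finally show ?case by simp
next
  case (Cons n \<alpha>)
  let ?e = "ev (scal_fps w * x) \<alpha>"
  let ?g = "\<lambda>\<beta>. case \<beta> of [] \<Rightarrow> 0 |
    m # \<gamma> \<Rightarrow> if m \<le> n then w (n - m) * mul_mat w \<alpha> \<gamma> else 0"
  have first: "(\<Sum>\<beta>\<in>comps_less k. scal (w n * mul_mat w \<alpha> \<beta>) * ev x \<beta>) = scal (w n) * ?e"
    using Cons.prems by (subst Cons.IH[of k, symmetric])
      (simp_all add: sum_distrib_left scal_mult mult.assoc)
  have "(\<Sum>\<beta>\<in>comps_less k. scal (?g \<beta>) * ev x \<beta>) =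
      (\<Sum>m=1..<k. \<Sum>\<beta>\<in>comps_less (k - m). scal (?g (m # \<beta>)) * ev x (m # \<beta>))"
    using Cons.prems by (subst sum_comps_less_Cons) simp_all
  also have "\<dots> = (\<Sum>m=1..<k. if m \<le> n then scal (w (n - m)) * fps_nth x m * ?e else 0)"
  proof (rule sum.cong)
    fix m assume m: "m \<in> {1..<k}"
    show "(\<Sum>\<beta>\<in>comps_less (k - m). scal (?g (m # \<beta>)) * ev x (m # \<beta>)) =
      (if m \<le> n then scal (w (n - m)) * fps_nth x m * ?e else 0)"
    proof (cases "m \<le> n")
      case True
      have "scal (?g (m # \<beta>)) * ev x (m # \<beta>) =
          scal (w (n - m)) * fps_nth x m * (scal (mul_mat w \<alpha> \<beta>) * ev x \<beta>)" for \<beta>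
      proof -
        \<comment> \<open>The scalar passes the generator that was split off.\<close>
        have "scal (mul_mat w \<alpha> \<beta>) * (fps_nth x m * ev x \<beta>) =
            fps_nth x m * (scal (mul_mat w \<alpha> \<beta>) * ev x \<beta>)"
          by (simp add: scal_central flip: mult.assoc)
        then show ?thesis using True by (simp add: scal_mult mult.assoc)
      qed
      then have "(\<Sum>\<beta>\<in>comps_less (k - m). scal (?g (m # \<beta>)) * ev x (m # \<beta>)) =
          scal (w (n - m)) * fps_nth x m *
            (\<Sum>\<beta>\<in>comps_less (k - m). scal (mul_mat w \<alpha> \<beta>) * ev x \<beta>)"
        by (simp only: sum_distrib_left)
      moreover have "sum_list \<alpha> < k - m"
        using True Cons.prems by simp
      ultimately show ?thesis
        using True Cons.prems by (simp only: Cons.IH composition_Cons) simp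
    qed simp
  qed simp
  also have "\<dots> = (\<Sum>m=1..n. scal (w (n - m)) * fps_nth x m * ?e)"
    using Cons.prems by (intro sum.mono_neutral_cong_right) auto
  finally have "(\<Sum>\<beta>\<in>comps_less k. scal (mul_mat w (n # \<alpha>) \<beta>) * ev x \<beta>) =
      scal (w n) * ?e + (\<Sum>m=1..n. scal (w (n - m)) * fps_nth x m * ?e)"
    by (simp add: scal_add distrib_right sum.distrib first)
  also have "\<dots> = (\<Sum>m=0..n. scal (w (n - m)) * fps_nth x m) * ?e"
    using assms(3) by (simp add: distrib_right sum_distrib_right sum.atLeast_Suc_atMost[of 0 n])
  also have "(\<Sum>m=0..n. scal (w (n - m)) * fps_nth x m) = fps_nth (scal_fps w * x) n"
    unfolding fps_mult_nth scal_fps_def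
    by (rule sum.reindex_bij_witness[of _ "\<lambda>i. n - i" "\<lambda>i. n - i"]) auto
  finally show ?case by simp
qed

definition refine_mat :: mat where
  "refine_mat \<alpha> \<beta> = (if coarsens \<alpha> \<beta> then (-1) ^ length \<beta> else 0)"

lemma refine_mat_Cons_Cons:
  assumes "composition \<beta>"
  shows "refine_mat (n # \<alpha>) (m # \<beta>) =
    (if m = n then - refine_mat \<alpha> \<beta>
     else if m < n then - refine_mat ((n - m) # \<alpha>) \<beta> else 0)"
  using assms by (auto simp: refine_mat_def coarsens_Cons_Cons)

text \<open>
  For a single part this is the expansion of \<open>1 / (1 + (x - 1))\<close> as a geometric series. Splitting off
  the first part of \<open>\<beta>\<close> gives the recursion \<open>y\<^sub>n = - (x\<^sub>1 y\<^sub>n\<^sub>-\<^sub>1 + \<dots> + x\<^sub>n y\<^sub>0)\<close>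
  for the coefficients of the inverse series.
\<close>

lemma refine_mat_ev:
  assumes "composition \<alpha>" "sum_list \<alpha> < k" "fps_nth x 0 = 1" "x * y = 1"
  shows "(\<Sum>\<beta>\<in>comps_less k. scal (refine_mat \<alpha> \<beta>) * ev x \<beta>) = ev y \<alpha>"
  using assms(1,2)
proof (induction "sum_list \<alpha>" arbitrary: \<alpha> k rule: less_induct)
  case less
  have y0: "fps_nth y 0 = 1"
    using arg_cong[OF assms(4), of "\<lambda>f. fps_nth f 0"] assms(3) by simp
  show ?case
  proof (cases \<alpha>)
    case Nil
    have "(\<Sum>\<beta>\<in>comps_less k. scal (refine_mat [] \<beta>) * ev x \<beta>) =
        (\<Sum>\<beta>\<in>comps_less k. if \<beta> = [] then 1 else 0)"
      by (rule sum.cong) (auto simp: refine_mat_def coarsens_Nil)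
    also have "\<dots> = 1"
      using less Nil by (subst sum_comps_less_Cons) simp_all
    finally show ?thesis using Nil by simp
  next
    case (Cons n \<gamma>)
    have n: "0 < n" "composition \<gamma>" "n + sum_list \<gamma> < k"
      using less.prems Cons by auto
    have "(\<Sum>\<beta>\<in>comps_less k. scal (refine_mat (n # \<gamma>) \<beta>) * ev x \<beta>) =
        (\<Sum>m=1..<k. \<Sum>\<beta>\<in>comps_less (k - m). scal (refine_mat (n # \<gamma>) (m # \<beta>)) * ev x (m # \<beta>))"
      using n by (subst sum_comps_less_Cons) (simp_all add: refine_mat_def coarsens_Cons_Nil)
    also have "\<dots> = (\<Sum>m=1..<k. if m \<le> n then - (fps_nth x m * fps_nth y (n - m) * ev y \<gamma>) else 0)"
    proof (rule sum.cong)
      fix m assume m: "m \<in> {1..<k}"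
      \<comment> \<open>What is left of the composition to be refined after the part \<open>m\<close> has been used.\<close>
      define \<delta> where "\<delta> = (if m = n then \<gamma> else (n - m) # \<gamma>)"
      show "(\<Sum>\<beta>\<in>comps_less (k - m). scal (refine_mat (n # \<gamma>) (m # \<beta>)) * ev x (m # \<beta>)) =
        (if m \<le> n then - (fps_nth x m * fps_nth y (n - m) * ev y \<gamma>) else 0)"
      proof (cases "m \<le> n")
        case True
        have "scal (refine_mat (n # \<gamma>) (m # \<beta>)) * ev x (m # \<beta>) =
            - fps_nth x m * (scal (refine_mat \<delta> \<beta>) * ev x \<beta>)"
          if "\<beta> \<in> comps_less (k - m)" for \<beta>
        proof -
          have "scal (refine_mat \<delta> \<beta>) * (fps_nth x m * ev x \<beta>) =
              fps_nth x m * (scal (refine_mat \<delta> \<beta>) * ev x \<beta>)"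
            by (simp add: scal_central flip: mult.assoc)
          moreover have "refine_mat (n # \<gamma>) (m # \<beta>) = - refine_mat \<delta> \<beta>"
            using that True by (subst refine_mat_Cons_Cons) (auto simp: \<delta>_def comps_less_def)
          ultimately show ?thesis by (simp add: scal_uminus)
        qed
        then have "(\<Sum>\<beta>\<in>comps_less (k - m). scal (refine_mat (n # \<gamma>) (m # \<beta>)) * ev x (m # \<beta>)) =
            - fps_nth x m * (\<Sum>\<beta>\<in>comps_less (k - m). scal (refine_mat \<delta> \<beta>) * ev x \<beta>)"
          by (simp add: sum_distrib_left)
        also have "(\<Sum>\<beta>\<in>comps_less (k - m). scal (refine_mat \<delta> \<beta>) * ev x \<beta>) = ev y \<delta>"
          by (rule less.hyps) (use n m True Cons in \<open>auto simp: \<delta>_def\<close>)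
        also have "ev y \<delta> = fps_nth y (n - m) * ev y \<gamma>"
          using True y0 by (auto simp: \<delta>_def)
        finally show ?thesis using True by (simp add: mult.assoc)
      next
        case False
        then show ?thesis
          by (intro sum.neutral[THEN trans])
            (auto simp: refine_mat_Cons_Cons comps_less_def)
      qed
    qed simp
    also have "\<dots> = (\<Sum>m=1..n. - (fps_nth x m * fps_nth y (n - m) * ev y \<gamma>))"
      using n by (intro sum.mono_neutral_cong_right) auto
    also have "\<dots> = - (\<Sum>m=1..n. fps_nth x m * fps_nth y (n - m)) * ev y \<gamma>"
      by (simp add: sum_negf sum_distrib_right)
    also have "- (\<Sum>m=1..n. fps_nth x m * fps_nth y (n - m)) = fps_nth y n"
      using arg_cong[OF assms(4), of "\<lambda>f. fps_nth f n"] n assms(3)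
      by (simp add: fps_mult_nth sum.atLeast_Suc_atMost[of 0 n] add_eq_0_iff)
    finally show ?thesis by (simp add: Cons)
  qed
qed

definition transforms :: "nat \<Rightarrow> mat \<Rightarrow> nsym fps \<Rightarrow> nsym fps \<Rightarrow> bool" where
  "transforms k M x y \<longleftrightarrow>
     (\<forall>\<alpha>\<in>comps_less k. (\<Sum>\<beta>\<in>comps_less k. scal (M \<alpha> \<beta>) * ev x \<beta>) = ev y \<alpha>)"

text \<open>
  Matrix multiplication is composition of substitutions, the left factor being applied to the result
  of the right one.
\<close>

lemma transforms_mat_mult:
  assumes "transforms k M y z" "transforms k N x y"
  shows "transforms k (mat_mult k M N) x z"
  unfolding transforms_def
proof
  fix \<alpha> assume \<alpha>: "\<alpha> \<in> comps_less k"
  have "(\<Sum>\<beta>\<in>comps_less k. scal (mat_mult k M N \<alpha> \<beta>) * ev x \<beta>) =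
      (\<Sum>\<beta>\<in>comps_less k. \<Sum>\<nu>\<in>comps_less k. scal (M \<alpha> \<nu>) * (scal (N \<nu> \<beta>) * ev x \<beta>))"
    by (simp add: mat_mult_def scal_sum scal_mult sum_distrib_right mult.assoc)
  also have "\<dots> = (\<Sum>\<nu>\<in>comps_less k. \<Sum>\<beta>\<in>comps_less k. scal (M \<alpha> \<nu>) * (scal (N \<nu> \<beta>) * ev x \<beta>))"
    by (rule sum.swap)
  also have "\<dots> = (\<Sum>\<nu>\<in>comps_less k. scal (M \<alpha> \<nu>) * ev y \<nu>)"
    using assms(2) by (simp add: transforms_def flip: sum_distrib_left)
  also have "\<dots> = ev z \<alpha>"
    using assms(1) \<alpha> by (simp add: transforms_def)
  finally show "(\<Sum>\<beta>\<in>comps_less k. scal (mat_mult k M N \<alpha> \<beta>) * ev x \<beta>) = ev z \<alpha>" .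
qed

lemma transforms_A_mat:
  assumes "fps_nth x 0 = 1"
  shows "transforms k A_mat x (scal_fps \<aa> * x)"
  unfolding transforms_def
proof
  fix \<alpha> assume \<alpha>: "\<alpha> \<in> comps_less k"
  then have "(\<Sum>\<beta>\<in>comps_less k. scal (A_mat \<alpha> \<beta>) * ev x \<beta>) =
      (\<Sum>\<beta>\<in>comps_less k. scal (mul_mat \<aa> \<alpha> \<beta>) * ev x \<beta>)"
    by (intro sum.cong) (auto simp: comps_less_def A_mat_eq_mul_mat)
  also have "\<dots> = ev (scal_fps \<aa> * x) \<alpha>"
    using \<alpha> assms by (intro mul_mat_ev) (auto simp: comps_less_def)
  finally show "(\<Sum>\<beta>\<in>comps_less k. scal (A_mat \<alpha> \<beta>) * ev x \<beta>) = ev (scal_fps \<aa> * x) \<alpha>" .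
qed

lemma transforms_refine_mat:
  assumes "fps_nth x 0 = 1" "x * y = 1"
  shows "transforms k refine_mat x y"
  unfolding transforms_def
proof
  fix \<alpha> assume "\<alpha> \<in> comps_less k"
  then show "(\<Sum>\<beta>\<in>comps_less k. scal (refine_mat \<alpha> \<beta>) * ev x \<beta>) = ev y \<alpha>"
    using assms by (intro refine_mat_ev) (auto simp: comps_less_def)
qed

definition mat_eq :: "nat \<Rightarrow> mat \<Rightarrow> mat \<Rightarrow> bool" where
  "mat_eq k M N \<longleftrightarrow> (\<forall>\<alpha>\<in>comps_less k. \<forall>\<beta>\<in>comps_less k. M \<alpha> \<beta> = N \<alpha> \<beta>)"

definition generic :: "nsym fps" where
  "generic = Abs_fps (\<lambda>n. Poly_Mapping.single (if n = 0 then [] else [n]) 1)"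

lemma generic_0 [simp]: "fps_nth generic 0 = 1"
  by (simp add: generic_def flip: zero_list_def)

lemma ev_generic: "composition \<alpha> \<Longrightarrow> ev generic \<alpha> = Poly_Mapping.single \<alpha> 1"
proof (induction \<alpha>)
  case Nil
  show ?case using single_one[where 'a = "nat list"] by (simp add: zero_list_def)
next
  case (Cons n \<alpha>)
  then show ?case by (simp add: generic_def mult_single plus_list_def)
qed

text \<open>
  Distinct compositions give distinct words, which are linearly independent. A matrix is therefore
  determined by its effect on the series \<open>H(T)\<close> of the generators.
\<close>

lemma mat_eq_id_if_transforms_generic:
  assumes "transforms k M generic generic"
  shows "mat_eq k M mat_id"
  unfolding mat_eq_def
proof (intro ballI)
  fix \<alpha> \<beta> assume \<alpha>: "\<alpha> \<in> comps_less k" and \<beta>: "\<beta> \<in> comps_less k"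
  have "Poly_Mapping.single \<alpha> 1 = (\<Sum>\<gamma>\<in>comps_less k. scal (M \<alpha> \<gamma>) * ev generic \<gamma>)"
    using assms \<alpha> by (simp add: transforms_def ev_generic comps_less_def)
  also have "\<dots> = (\<Sum>\<gamma>\<in>comps_less k. Poly_Mapping.single \<gamma> (M \<alpha> \<gamma>))"
    by (intro sum.cong)
      (auto simp: comps_less_def ev_generic scal_def mult_single plus_list_def zero_list_def)
  finally have "Poly_Mapping.lookup (Poly_Mapping.single \<alpha> 1) \<beta> =
      Poly_Mapping.lookup (\<Sum>\<gamma>\<in>comps_less k. Poly_Mapping.single \<gamma> (M \<alpha> \<gamma>)) \<beta>"
    by simp
  also have "\<dots> = M \<alpha> \<beta>"
    using \<beta> finite_comps_less[of k] by (simp add: lookup_sum lookup_single when_def sum.delta)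
  finally show "M \<alpha> \<beta> = mat_id \<alpha> \<beta>"
    by (simp add: mat_id_def lookup_single when_def split: if_splits)
qed

text \<open>
  With \<open>y = (a H)\<^sup>-\<^sup>1\<close>, the first factor leads from \<open>H\<close> to \<open>y\<close>, and the second from \<open>y\<close> to
  \<open>(a y)\<^sup>-\<^sup>1 = H\<close>; here \<open>a y H = 1\<close> since \<open>a\<close> is central and \<open>y\<close> is a two-sided inverse.
\<close>

lemma refine_A_involution:
  "mat_eq k (mat_mult k (mat_mult k refine_mat A_mat) (mat_mult k refine_mat A_mat)) mat_id"
proof (rule mat_eq_id_if_transforms_generic)
  let ?a = "scal_fps \<aa>"
  have a0: "fps_nth ?a 0 = 1" by (simp add: scal_fps_def)
  define y where "y = fps_right_inverse (?a * generic) 1"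
  have right: "?a * generic * y = 1" and left: "y * (?a * generic) = 1"
    unfolding y_def by (rule fps_right_inverse, simp add: a0)
      (rule fps_left_inverse'[of 1], simp_all add: a0)
  have y0: "fps_nth y 0 = 1" by (simp add: y_def)
  have back_eq: "?a * y * generic = 1"
    using left by (metis mult.assoc scal_fps_central)
  have "transforms k (mat_mult k refine_mat A_mat) generic y"
    by (rule transforms_mat_mult[OF transforms_refine_mat transforms_A_mat])
      (simp_all add: a0 right)
  moreover have "transforms k (mat_mult k refine_mat A_mat) y generic"
    by (rule transforms_mat_mult[OF transforms_refine_mat transforms_A_mat])
      (simp_all add: a0 y0 back_eq)
  ultimately show "transforms k
      (mat_mult k (mat_mult k refine_mat A_mat) (mat_mult k refine_mat A_mat)) generic generic"
    by (rule transforms_mat_mult[rotated])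
qed

section \<open>Matrices on a finite set of compositions\<close>

lemma mat_mult_assoc: "mat_mult k (mat_mult k L M) N = mat_mult k L (mat_mult k M N)"
proof (intro ext)
  fix \<alpha> \<beta>
  have "mat_mult k (mat_mult k L M) N \<alpha> \<beta> =
      (\<Sum>\<nu>\<in>comps_less k. \<Sum>\<rho>\<in>comps_less k. L \<alpha> \<rho> * (M \<rho> \<nu> * N \<nu> \<beta>))"
    by (simp add: mat_mult_def sum_distrib_right mult.assoc)
  also have "\<dots> = (\<Sum>\<rho>\<in>comps_less k. \<Sum>\<nu>\<in>comps_less k. L \<alpha> \<rho> * (M \<rho> \<nu> * N \<nu> \<beta>))"
    by (rule sum.swap)
  finally show "mat_mult k (mat_mult k L M) N \<alpha> \<beta> = mat_mult k L (mat_mult k M N) \<alpha> \<beta>"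
    by (simp add: mat_mult_def sum_distrib_left)
qed

lemma mat_eq_refl: "mat_eq k M M"
  and mat_eq_sym: "mat_eq k M N \<Longrightarrow> mat_eq k N M"
  and mat_eq_trans [trans]: "mat_eq k L M \<Longrightarrow> mat_eq k M N \<Longrightarrow> mat_eq k L N"
  by (simp_all add: mat_eq_def)

lemma mat_eq_mult: "mat_eq k M M' \<Longrightarrow> mat_eq k N N' \<Longrightarrow> mat_eq k (mat_mult k M N) (mat_mult k M' N')"
  by (auto simp: mat_eq_def mat_mult_def intro!: sum.cong)

lemma sum_mat_id:
  assumes "\<alpha> \<in> comps_less k"
  shows "(\<Sum>\<nu>\<in>comps_less k. mat_id \<alpha> \<nu> * f \<nu>) = f \<alpha>"
    "(\<Sum>\<nu>\<in>comps_less k. f \<nu> * mat_id \<nu> \<alpha>) = f \<alpha>"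
proof -
  have "(\<Sum>\<nu>\<in>comps_less k. mat_id \<alpha> \<nu> * f \<nu>) = (\<Sum>\<nu>\<in>comps_less k. if \<nu> = \<alpha> then f \<nu> else 0)"
    "(\<Sum>\<nu>\<in>comps_less k. f \<nu> * mat_id \<nu> \<alpha>) = (\<Sum>\<nu>\<in>comps_less k. if \<nu> = \<alpha> then f \<nu> else 0)"
    by (auto simp: mat_id_def intro!: sum.cong)
  then show "(\<Sum>\<nu>\<in>comps_less k. mat_id \<alpha> \<nu> * f \<nu>) = f \<alpha>"
    "(\<Sum>\<nu>\<in>comps_less k. f \<nu> * mat_id \<nu> \<alpha>) = f \<alpha>"
    using assms by (simp_all add: sum.delta finite_comps_less)
qed

lemma mat_eq_id_mult: "mat_eq k (mat_mult k mat_id M) M"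
  and mat_eq_mult_id: "mat_eq k (mat_mult k M mat_id) M"
  by (simp_all add: mat_eq_def mat_mult_def sum_mat_id)

text \<open>
  Every proper prefix of \<open>\<beta>\<close> is a prefix of \<open>\<beta>'\<close>, and \<open>\<beta>\<close> has one part more than \<open>\<beta>'\<close>. Hence in the
  sum \<open>K\<^sub>\<alpha>\<^sub>\<beta> + K\<^sub>\<alpha>\<^sub>\<beta>\<^sub>'\<close> everything cancels except the prefix \<open>\<beta>\<close> itself.
\<close>

lemma K_Z_eq_refine: "mat_eq k (mat_mult k K_mat Z_mat) refine_mat"
  unfolding mat_eq_def
proof (intro ballI)
  fix \<alpha> \<beta> assume \<alpha>: "\<alpha> \<in> comps_less k" and \<beta>: "\<beta> \<in> comps_less k"
  show "mat_mult k K_mat Z_mat \<alpha> \<beta> = refine_mat \<alpha> \<beta>"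
  proof (cases \<beta> rule: rev_cases)
    case Nil
    have "mat_mult k K_mat Z_mat \<alpha> \<beta> = (\<Sum>\<nu>\<in>comps_less k. if \<nu> = \<beta> then K_mat \<alpha> \<nu> else 0)"
      unfolding mat_mult_def by (intro sum.cong) (auto simp: Z_mat_def Nil)
    also have "\<dots> = K_mat \<alpha> \<beta>" using \<beta> finite_comps_less[of k] by (simp only: sum.delta if_True)
    finally show ?thesis by (simp add: Nil K_mat_def refine_mat_def)
  next
    case (snoc \<gamma> b)
    then have \<gamma>: "\<gamma> \<in> comps_less k" and b: "0 < b"
      using \<beta> by (auto simp: comps_less_def)
    have "mat_mult k K_mat Z_mat \<alpha> \<beta> = (\<Sum>\<nu>\<in>comps_less k.
        (if \<nu> = \<beta> then K_mat \<alpha> \<nu> else 0) + (if \<nu> = \<gamma> then K_mat \<alpha> \<nu> else 0))"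
      unfolding mat_mult_def by (intro sum.cong) (auto simp: Z_mat_def snoc)
    also have "\<dots> = K_mat \<alpha> \<beta> + K_mat \<alpha> \<gamma>"
      using \<beta> \<gamma> finite_comps_less[of k] by (simp only: sum.distrib sum.delta if_True)
    also have "\<dots> = refine_mat \<alpha> \<beta>"
    proof -
      have "sum_list \<nu> < sum_list \<beta>" if "prefix \<nu> \<gamma>" for \<nu>
        using that b by (auto simp: snoc prefix_def)
      then have "\<not> (coarsens \<alpha> \<beta> \<and> (\<exists>\<nu>. prefix \<nu> \<gamma> \<and> coarsens \<alpha> \<nu>))"
        using coarsens_sum[of \<alpha>] by (metis less_irrefl)
      moreover have "(\<exists>\<nu>. prefix \<nu> \<beta> \<and> coarsens \<alpha> \<nu>) \<longleftrightarrow>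
          coarsens \<alpha> \<beta> \<or> (\<exists>\<nu>. prefix \<nu> \<gamma> \<and> coarsens \<alpha> \<nu>)"
        unfolding snoc prefix_snoc by blast
      ultimately show ?thesis
        by (auto simp: K_mat_def refine_mat_def snoc)
    qed
    finally show ?thesis .
  qed
qed

lemma K_Z_A_involution:
  "mat_eq k (mat_mult k K_mat (mat_mult k (mat_mult k Z_mat A_mat)
     (mat_mult k K_mat (mat_mult k Z_mat A_mat)))) mat_id"
proof -
  have eq: "mat_eq k (mat_mult k K_mat (mat_mult k Z_mat A_mat)) (mat_mult k refine_mat A_mat)"
    unfolding mat_mult_assoc[symmetric] by (intro mat_eq_mult mat_eq_refl K_Z_eq_refine)
  have "mat_eq k (mat_mult k (mat_mult k K_mat (mat_mult k Z_mat A_mat))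
      (mat_mult k K_mat (mat_mult k Z_mat A_mat)))
    (mat_mult k (mat_mult k refine_mat A_mat) (mat_mult k refine_mat A_mat))"
    by (intro mat_eq_mult eq)
  also have "mat_eq k \<dots> mat_id"
    by (rule refine_A_involution)
  finally show ?thesis by (simp add: mat_mult_assoc)
qed

section \<open>The block decomposition\<close>

text \<open>
  The inverse of \<open>\<lambda> \<mapsto> \<lambda>'\<close>, from compositions of size less than \<open>k\<close> to compositions of \<open>k\<close>.
\<close>

definition extend :: "nat \<Rightarrow> nat list \<Rightarrow> nat list" where
  "extend k \<alpha> = \<alpha> @ [k - sum_list \<alpha>]"

lemma butlast_extend [simp]: "butlast (extend k \<alpha>) = \<alpha>"
  by (simp add: extend_def)

lemma extend_eq_iff [simp]: "extend k \<alpha> = extend k \<beta> \<longleftrightarrow> \<alpha> = \<beta>"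
  by (metis butlast_extend)

lemma sum_list_extend [simp]: "\<alpha> \<in> comps_less k \<Longrightarrow> sum_list (extend k \<alpha>) = k"
  by (simp add: extend_def comps_less_def)

lemma comps_less_Suc:
  assumes "0 < k"
  shows "comps_less (Suc k) = comps_less k \<union> extend k ` comps_less k"
proof (intro equalityI subsetI)
  fix \<alpha> assume \<alpha>: "\<alpha> \<in> comps_less (Suc k)"
  show "\<alpha> \<in> comps_less k \<union> extend k ` comps_less k"
  proof (cases "sum_list \<alpha> < k")
    case False
    with \<alpha> have "sum_list \<alpha> = k" by (simp add: comps_less_def)
    with assms obtain \<gamma> x where "\<alpha> = \<gamma> @ [x]" by (cases \<alpha> rule: rev_cases) auto
    with \<alpha> \<open>sum_list \<alpha> = k\<close> have "\<gamma> \<in> comps_less k" "\<alpha> = extend k \<gamma>"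
      by (auto simp: comps_less_def extend_def)
    then show ?thesis by blast
  qed (use \<alpha> in \<open>simp add: comps_less_def\<close>)
qed (auto simp: comps_less_def extend_def)

lemma extend_neq:
  assumes "\<alpha> \<in> comps_less k" "\<beta> \<in> comps_less k"
  shows "\<alpha> \<noteq> extend k \<beta>" "extend k \<beta> \<noteq> \<alpha>"
  using sum_list_extend[OF assms(2)] assms(1) by (auto simp: comps_less_def)

lemma sum_comps_less_Suc:
  assumes "0 < k"
  shows "(\<Sum>\<alpha>\<in>comps_less (Suc k). f \<alpha>) = (\<Sum>\<alpha>\<in>comps_less k. f \<alpha> + f (extend k \<alpha>))"
proof -
  have "comps_less k \<inter> extend k ` comps_less k = {}"
    using extend_neq by blast
  then show ?thesis
    by (simp add: comps_less_Suc[OF assms] sum.union_disjoint finite_comps_less sum.reindex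
        inj_on_def sum.distrib)
qed

lemma mat_eq_SucI:
  assumes "0 < k"
    "\<And>\<alpha> \<beta>. \<alpha> \<in> comps_less k \<Longrightarrow> \<beta> \<in> comps_less k \<Longrightarrow> M \<alpha> \<beta> = N \<alpha> \<beta>"
    "\<And>\<alpha> \<beta>. \<alpha> \<in> comps_less k \<Longrightarrow> \<beta> \<in> comps_less k \<Longrightarrow> M \<alpha> (extend k \<beta>) = N \<alpha> (extend k \<beta>)"
    "\<And>\<alpha> \<beta>. \<alpha> \<in> comps_less k \<Longrightarrow> \<beta> \<in> comps_less k \<Longrightarrow> M (extend k \<alpha>) \<beta> = N (extend k \<alpha>) \<beta>"
    "\<And>\<alpha> \<beta>. \<alpha> \<in> comps_less k \<Longrightarrow> \<beta> \<in> comps_less k \<Longrightarrow>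
       M (extend k \<alpha>) (extend k \<beta>) = N (extend k \<alpha>) (extend k \<beta>)"
  shows "mat_eq (Suc k) M N"
  using assms(2-5) unfolding mat_eq_def comps_less_Suc[OF assms(1)] by blast

lemma mat_mult_SucI:
  "0 < k \<Longrightarrow> mat_mult (Suc k) M N \<alpha> \<beta> =
    (\<Sum>\<nu>\<in>comps_less k. M \<alpha> \<nu> * N \<nu> \<beta> + M \<alpha> (extend k \<nu>) * N (extend k \<nu>) \<beta>)"
  by (simp add: mat_mult_def sum_comps_less_Suc)

lemma block_diag_simps [simp]:
  assumes "\<alpha> \<in> comps_less k" "\<beta> \<in> comps_less k"
  shows "block_diag k M \<alpha> \<beta> = M \<alpha> \<beta>"
    "block_diag k M \<alpha> (extend k \<beta>) = 0"
    "block_diag k M (extend k \<alpha>) \<beta> = 0"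
    "block_diag k M (extend k \<alpha>) (extend k \<beta>) = M \<alpha> \<beta>"
  using assms by (simp_all add: block_diag_def) (auto simp: comps_less_def)

text \<open>
  The block matrix \<open>J\<close> with the rows \<open>(1, -1)\<close> and \<open>(0, -1)\<close>. The second block of columns consists of
  the compositions of size \<open>k\<close>; in such a column the two
  identity entries sit in different rows, \<open>\<beta>\<close> and \<open>\<beta>'\<close>.
\<close>

definition sign_mat :: "nat \<Rightarrow> mat" where
  "sign_mat k \<alpha> \<beta> = (if sum_list \<beta> < k then mat_id \<alpha> \<beta>
     else - mat_id \<alpha> \<beta> - mat_id \<alpha> (butlast \<beta>))"

lemma sign_mat_simps [simp]:
  assumes "\<alpha> \<in> comps_less k" "\<beta> \<in> comps_less k"
  shows "sign_mat k \<alpha> \<beta> = mat_id \<alpha> \<beta>"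
    "sign_mat k \<alpha> (extend k \<beta>) = - mat_id \<alpha> \<beta>"
    "sign_mat k (extend k \<alpha>) \<beta> = 0"
    "sign_mat k (extend k \<alpha>) (extend k \<beta>) = - mat_id \<alpha> \<beta>"
  using assms extend_neq[OF assms] extend_neq[OF assms(2,1)]
  by (simp_all add: sign_mat_def mat_id_def) (auto simp: comps_less_def)

lemma block_diag_mult:
  assumes "0 < k"
  shows "mat_eq (Suc k) (mat_mult (Suc k) (block_diag k M) (block_diag k N))
    (block_diag k (mat_mult k M N))"
  by (rule mat_eq_SucI[OF assms]) (simp_all add: mat_mult_SucI assms, simp_all add: mat_mult_def)

lemma block_diag_cong: "0 < k \<Longrightarrow> mat_eq k M N \<Longrightarrow> mat_eq (Suc k) (block_diag k M) (block_diag k N)"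
  by (rule mat_eq_SucI) (simp_all add: mat_eq_def)

lemma block_diag_id: "0 < k \<Longrightarrow> mat_eq (Suc k) (block_diag k mat_id) mat_id"
  by (rule mat_eq_SucI) (simp_all add: mat_id_def extend_neq)

lemma block_diag_sign_commute:
  assumes "0 < k"
  shows "mat_eq (Suc k) (mat_mult (Suc k) (sign_mat k) (block_diag k M))
    (mat_mult (Suc k) (block_diag k M) (sign_mat k))"
  by (rule mat_eq_SucI[OF assms]) (simp_all add: mat_mult_SucI assms sum_mat_id sum_negf)

lemma sign_mat_involution:
  assumes "0 < k"
  shows "mat_eq (Suc k) (mat_mult (Suc k) (sign_mat k) (sign_mat k)) mat_id"
  by (rule mat_eq_SucI[OF assms])
    (simp_all add: mat_mult_SucI assms sum_mat_id sum_negf extend_neq mat_id_def[of _ "extend _ _"]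
      mat_id_def[of "extend _ _"], simp_all add: mat_id_def)

text \<open>
  Let \<open>\<beta>\<close> have size \<open>k\<close>. A row \<open>\<alpha>\<close> of smaller size sees only the proper prefixes of \<open>\<beta>\<close>, that is, the
  prefixes of \<open>\<beta>'\<close>. A row \<open>\<alpha>\<close> of size \<open>k\<close> requires \<open>\<alpha> \<subseteq> \<beta>\<close>, which holds if and only if \<open>\<alpha>'\<close>
  coarsens a prefix of \<open>\<beta>'\<close>, the last part of \<open>\<alpha>\<close> absorbing what remains. In both cases the
  additional part of \<open>\<beta>\<close> changes the sign.
\<close>

lemma K_mat_block:
  assumes "0 < k"
  shows "mat_eq (Suc k) K_mat (mat_mult (Suc k) (block_diag k K_mat) (sign_mat k))"
proof (rule mat_eq_SucI[OF assms])
  fix \<alpha> \<beta> assume \<alpha>: "\<alpha> \<in> comps_less k" and \<beta>: "\<beta> \<in> comps_less k"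
  have sums: "sum_list \<alpha> < k" "sum_list \<beta> < k"
    using \<alpha> \<beta> by (simp_all add: comps_less_def)
  show "K_mat \<alpha> \<beta> = mat_mult (Suc k) (block_diag k K_mat) (sign_mat k) \<alpha> \<beta>"
    using \<alpha> \<beta> by (simp add: mat_mult_SucI assms sum_mat_id)
  have "\<not> coarsens \<alpha> (extend k \<beta>)"
    using coarsens_sum[of \<alpha> "extend k \<beta>"] \<beta> sums by auto
  then have "K_mat \<alpha> (extend k \<beta>) = - K_mat \<alpha> \<beta>"
    by (auto simp: K_mat_def extend_def)
  then show "K_mat \<alpha> (extend k \<beta>) =
      mat_mult (Suc k) (block_diag k K_mat) (sign_mat k) \<alpha> (extend k \<beta>)"
    using \<alpha> \<beta> by (simp add: mat_mult_SucI assms sum_mat_id sum_negf)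
  have "\<not> coarsens (extend k \<alpha>) \<nu>" if "prefix \<nu> \<beta>" for \<nu>
    using coarsens_sum[of "extend k \<alpha>" \<nu>] \<alpha> sums that by (auto simp: prefix_def)
  then have "K_mat (extend k \<alpha>) \<beta> = 0"
    by (auto simp: K_mat_def)
  then show "K_mat (extend k \<alpha>) \<beta> =
      mat_mult (Suc k) (block_diag k K_mat) (sign_mat k) (extend k \<alpha>) \<beta>"
    using \<alpha> \<beta> by (simp add: mat_mult_SucI assms)
  have "(\<exists>\<nu>. prefix \<nu> (extend k \<beta>) \<and> coarsens (extend k \<alpha>) \<nu>) \<longleftrightarrow>
      (\<exists>\<nu>. prefix \<nu> \<beta> \<and> coarsens \<alpha> \<nu>)"
  proof
    assume "\<exists>\<nu>. prefix \<nu> (extend k \<beta>) \<and> coarsens (extend k \<alpha>) \<nu>"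
    then obtain \<nu> where \<nu>: "prefix \<nu> (extend k \<beta>)" "coarsens (extend k \<alpha>) \<nu>" by blast
    then obtain \<gamma> \<delta> where \<gamma>: "\<nu> = \<gamma> @ \<delta>" "\<delta> \<noteq> []" "coarsens \<alpha> \<gamma>"
      unfolding extend_def coarsens_snoc by blast
    have "prefix (\<gamma> @ \<delta>) (\<beta> @ [k - sum_list \<beta>])"
      using \<nu>(1) \<gamma>(1) by (simp add: extend_def)
    then have "prefix \<gamma> \<beta>"
      using \<gamma>(2) append_prefixD prefix_snoc same_prefix_nil by metis
    with \<gamma>(3) show "\<exists>\<nu>. prefix \<nu> \<beta> \<and> coarsens \<alpha> \<nu>" by blast
  next
    assume "\<exists>\<nu>. prefix \<nu> \<beta> \<and> coarsens \<alpha> \<nu>"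
    then obtain \<gamma> \<delta> where \<gamma>: "\<beta> = \<gamma> @ \<delta>" "coarsens \<alpha> \<gamma>" by (auto simp: prefix_def)
    then have "coarsens (extend k \<alpha>) (extend k \<beta>)"
      unfolding extend_def coarsens_snoc using coarsens_sum[OF \<gamma>(2)] sums
      by (intro exI[of _ \<gamma>] exI[of _ "\<delta> @ [k - sum_list \<beta>]"]) auto
    then show "\<exists>\<nu>. prefix \<nu> (extend k \<beta>) \<and> coarsens (extend k \<alpha>) \<nu>" by blast
  qed
  then have "K_mat (extend k \<alpha>) (extend k \<beta>) = - K_mat \<alpha> \<beta>"
    unfolding K_mat_def by (simp add: extend_def)
  then show "K_mat (extend k \<alpha>) (extend k \<beta>) =
      mat_mult (Suc k) (block_diag k K_mat) (sign_mat k) (extend k \<alpha>) (extend k \<beta>)"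
    using \<alpha> \<beta> by (simp add: mat_mult_SucI assms sum_mat_id sum_negf)
qed

section \<open>The two recursions\<close>

text \<open>
  Since \<open>K = diag(K, K) J\<close>, each factor \<open>K\<close> at level \<open>k + 1\<close> can be absorbed into the adjacent
  block-diagonal matrix, and the factors \<open>J\<close> can be collected on the right.
\<close>

lemma block_induction_step:
  assumes k: "0 < k"
    and K2: "mat_eq k (mat_mult k K_mat K_mat) mat_id"
    and right: "mat_eq k (mat_mult k V (mat_mult k K_mat (mat_mult k U K_mat))) mat_id"
    and left: "mat_eq k (mat_mult k U (mat_mult k K_mat V)) K_mat"
  defines "V' \<equiv> block_diag k V" and "U' \<equiv> block_diag k U"
  shows "mat_eq (Suc k) (mat_mult (Suc k) K_mat K_mat) mat_id"
    and "mat_eq (Suc k) (mat_mult (Suc k) V' (mat_mult (Suc k) K_mat (mat_mult (Suc k) U' K_mat))) mat_id"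
    and "mat_eq (Suc k) (mat_mult (Suc k) U' (mat_mult (Suc k) K_mat V')) K_mat"
proof -
  let ?n = "Suc k"
  let ?m = "mat_mult (Suc k)"
  let ?D = "block_diag k" and ?J = "sign_mat k"
  have move: "mat_eq ?n (?m (?D M) K_mat) (?m (?D (mat_mult k M K_mat)) ?J)" for M
  proof -
    have "mat_eq ?n (?m (?D M) K_mat) (?m (?D M) (?m (?D K_mat) ?J))"
      by (intro mat_eq_mult mat_eq_refl K_mat_block k)
    also have "mat_eq ?n \<dots> (?m (?D (mat_mult k M K_mat)) ?J)"
      unfolding mat_mult_assoc[symmetric] by (intro mat_eq_mult mat_eq_refl block_diag_mult k)
    finally show ?thesis .
  qed
  have swap: "mat_eq ?n (?m (?m (?D M) ?J) (?D N)) (?m (?D (mat_mult k M N)) ?J)" for M N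
  proof -
    have "mat_eq ?n (?m (?m (?D M) ?J) (?D N)) (?m (?D M) (?m (?D N) ?J))"
      unfolding mat_mult_assoc by (intro mat_eq_mult mat_eq_refl block_diag_sign_commute k)
    also have "mat_eq ?n \<dots> (?m (?D (mat_mult k M N)) ?J)"
      unfolding mat_mult_assoc[symmetric] by (intro mat_eq_mult mat_eq_refl block_diag_mult k)
    finally show ?thesis .
  qed
  have cancel: "mat_eq ?n (?m (?m (?D M) ?J) (?m (?D N) ?J)) mat_id"
    if "mat_eq k (mat_mult k M N) mat_id" for M N
  proof -
    have "mat_eq ?n (?m (?m (?D M) ?J) (?m (?D N) ?J)) (?m (?m (?D (mat_mult k M N)) ?J) ?J)"
      unfolding mat_mult_assoc[symmetric, of ?n "?m (?D M) ?J"]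
      by (intro mat_eq_mult mat_eq_refl swap)
    also have "mat_eq ?n \<dots> (?m (?D (mat_mult k M N)) mat_id)"
      unfolding mat_mult_assoc by (intro mat_eq_mult mat_eq_refl sign_mat_involution k)
    also have "mat_eq ?n \<dots> (?D (mat_mult k M N))"
      by (rule mat_eq_mult_id)
    also have "mat_eq ?n \<dots> (?D mat_id)"
      by (intro block_diag_cong k that)
    also have "mat_eq ?n \<dots> mat_id"
      by (rule block_diag_id[OF k])
    finally show ?thesis .
  qed
  have "mat_eq ?n (?m K_mat K_mat) (?m (?m (?D K_mat) ?J) (?m (?D K_mat) ?J))"
    by (intro mat_eq_mult K_mat_block k)
  also have "mat_eq ?n \<dots> mat_id"
    by (rule cancel[OF K2])
  finally show "mat_eq ?n (?m K_mat K_mat) mat_id" .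
  have "mat_eq ?n (?m V' (?m K_mat (?m U' K_mat)))
      (?m (?m (?D (mat_mult k V K_mat)) ?J) (?m (?D (mat_mult k U K_mat)) ?J))"
    unfolding V'_def U'_def mat_mult_assoc[symmetric, of ?n "?D V"] by (rule mat_eq_mult[OF move move])
  also have "mat_eq ?n \<dots> mat_id"
    using right by (intro cancel) (simp add: mat_mult_assoc)
  finally show "mat_eq ?n (?m V' (?m K_mat (?m U' K_mat))) mat_id" .
  have "mat_eq ?n (?m U' (?m K_mat V')) (?m (?m (?D (mat_mult k U K_mat)) ?J) (?D V))"
    unfolding mat_mult_assoc[symmetric] V'_def U'_def by (rule mat_eq_mult[OF move mat_eq_refl])
  also have "mat_eq ?n \<dots> (?m (?D (mat_mult k (mat_mult k U K_mat) V)) ?J)"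
    by (rule swap)
  also have "mat_eq ?n \<dots> (?m (?D K_mat) ?J)"
    using left by (intro mat_eq_mult mat_eq_refl block_diag_cong k) (simp add: mat_mult_assoc)
  also have "mat_eq ?n \<dots> K_mat"
    by (rule mat_eq_sym[OF K_mat_block[OF k]])
  finally show "mat_eq ?n (?m U' (?m K_mat V')) K_mat" .
qed

text \<open>
  Both orders of the product are carried through the induction, together with \<open>K\<^sup>2 = 1\<close>.
  Each order is reduced to the previous level by a different identity: the first uses
  \<open>Z A K Z A = K\<close>, the second uses \<open>diag(\<Upsilon>, \<Upsilon>) K diag(\<Xi>, \<Xi>) = K\<close> and then \<open>(K Z A)\<^sup>2 = 1\<close>.
\<close>

lemma inverse_pair_induction:
  "mat_eq (Suc j) (mat_mult (Suc j) K_mat K_mat) mat_id \<and>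
   mat_eq (Suc j) (mat_mult (Suc j) (\<Xi> (Suc j))
     (mat_mult (Suc j) K_mat (mat_mult (Suc j) (\<Upsilon> (Suc j)) K_mat))) mat_id \<and>
   mat_eq (Suc j) (mat_mult (Suc j) K_mat (mat_mult (Suc j) (\<Upsilon> (Suc j))
     (mat_mult (Suc j) K_mat (\<Xi> (Suc j))))) mat_id"
proof (induction j)
  case 0
  have [simp]: "comps_less (Suc 0) = {[]}"
  proof (intro equalityI subsetI)
    fix \<alpha> assume "\<alpha> \<in> comps_less (Suc 0)"
    then show "\<alpha> \<in> {[]}" by (cases \<alpha>) (auto simp: comps_less_def)
  qed (simp add: comps_less_def)
  have [simp]: "K_mat [] [] = 1"
    by (simp add: K_mat_def coarsens_Nil)
  show ?case by (simp add: mat_eq_def mat_mult_def mat_id_def)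
next
  case (Suc j)
  define k where "k = Suc j"
  have k: "0 < k" by (simp add: k_def)
  let ?n = "Suc k"
  let ?m = "mat_mult (Suc k)"
  define X where "X = ?m Z_mat A_mat"
  define U where "U = block_diag k (\<Upsilon> k)"
  define V where "V = block_diag k (\<Xi> k)"
  have IH: "mat_eq k (mat_mult k K_mat K_mat) mat_id"
      "mat_eq k (mat_mult k (\<Xi> k) (mat_mult k K_mat (mat_mult k (\<Upsilon> k) K_mat))) mat_id"
      "mat_eq k (mat_mult k K_mat (mat_mult k (\<Upsilon> k) (mat_mult k K_mat (\<Xi> k)))) mat_id"
    using Suc.IH by (simp_all add: k_def)
  have "mat_eq k (mat_mult k (\<Upsilon> k) (mat_mult k K_mat (\<Xi> k)))
      (mat_mult k mat_id (mat_mult k (\<Upsilon> k) (mat_mult k K_mat (\<Xi> k))))"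
    by (rule mat_eq_sym[OF mat_eq_id_mult])
  also have "mat_eq k \<dots> (mat_mult k (mat_mult k K_mat K_mat)
      (mat_mult k (\<Upsilon> k) (mat_mult k K_mat (\<Xi> k))))"
    by (intro mat_eq_mult mat_eq_refl mat_eq_sym[OF IH(1)])
  also have "mat_eq k \<dots> (mat_mult k K_mat mat_id)"
    unfolding mat_mult_assoc[of k K_mat K_mat] by (intro mat_eq_mult mat_eq_refl IH(3))
  also have "mat_eq k \<dots> K_mat"
    by (rule mat_eq_mult_id)
  finally have left: "mat_eq k (mat_mult k (\<Upsilon> k) (mat_mult k K_mat (\<Xi> k))) K_mat" .
  note step = block_induction_step[OF k IH(1,2) left, folded U_def V_def]
  have inv: "mat_eq ?n (?m K_mat (?m X (?m K_mat X))) mat_id"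
    unfolding X_def by (rule K_Z_A_involution)
  have "mat_eq ?n (?m X (?m K_mat X)) (?m mat_id (?m X (?m K_mat X)))"
    by (rule mat_eq_sym[OF mat_eq_id_mult])
  also have "mat_eq ?n \<dots> (?m (?m K_mat K_mat) (?m X (?m K_mat X)))"
    by (intro mat_eq_mult mat_eq_refl mat_eq_sym[OF step(1)])
  also have "mat_eq ?n \<dots> (?m K_mat mat_id)"
    unfolding mat_mult_assoc[of ?n K_mat K_mat] by (intro mat_eq_mult mat_eq_refl inv)
  also have "mat_eq ?n \<dots> K_mat"
    by (rule mat_eq_mult_id)
  finally have XKX: "mat_eq ?n (?m X (?m K_mat X)) K_mat" .
  have Xi: "\<Xi> ?n = ?m V X" and Upsilon: "\<Upsilon> ?n = ?m X U"
    by (simp_all add: k_def V_def U_def X_def mat_mult_assoc)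
  have "mat_eq ?n (?m V (?m (?m X (?m K_mat X)) (?m U K_mat))) (?m V (?m K_mat (?m U K_mat)))"
    by (intro mat_eq_mult mat_eq_refl XKX)
  also note step(2)
  finally have 1: "mat_eq ?n (?m (\<Xi> ?n) (?m K_mat (?m (\<Upsilon> ?n) K_mat))) mat_id"
    by (simp only: Xi Upsilon mat_mult_assoc)
  have "mat_eq ?n (?m K_mat (?m X (?m (?m U (?m K_mat V)) X))) (?m K_mat (?m X (?m K_mat X)))"
    by (intro mat_eq_mult mat_eq_refl step(3))
  also note inv
  finally have 2: "mat_eq ?n (?m K_mat (?m (\<Upsilon> ?n) (?m K_mat (\<Xi> ?n)))) mat_id"
    by (simp only: Xi Upsilon mat_mult_assoc)
  from step(1) 1 2 show ?case unfolding k_def by blast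
qed

theorem lemma5p5:
  fixes k :: nat
  assumes "k \<ge> 1"
  shows "mutually_inverse k (\<Xi> k) (mat_mult k (mat_mult k K_mat (\<Upsilon> k)) K_mat)"
proof -
  obtain j where j: "k = Suc j"
    using assms by (cases k) auto
  show ?thesis
    using inverse_pair_induction[of j]
    unfolding mutually_inverse_def j by (simp add: mat_mult_assoc mat_eq_def)
qed

end
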